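(* Let $M$ be a compact, connected Riemannian manifold without boundary, let $r\ge 1$ be an integer, and let $(X_t)_t$ be the flow generated by $X\in\mathfrak{X}^r(M)$. Assume that $\Lambda\subset M$ is a compact, $(X_t)_t$-invariant and transitive subset. If the set of hyperbolic periodic orbits of $(X_t)_t$ is dense in $\Lambda$, then the centralizer $\mathcal{Z}^1(X|_\Lambda)$ is trivial, that is: if $Y\in\mathcal{Z}^1(X)$, then the flow $(Y_t)_t$ generated by $Y$ preserves $\Lambda$ and there exists $c\in\mathbb{R}$ such that $Y|_\Lambda = c\,X|_\Lambda$.
   Context: $\mathfrak{X}^r(M)$ is the space of $C^r$ vector fields on $M$. The centralizer of $X$ is $\mathcal{Z}^1(X)=\{Y\in\mathfrak{X}^1(M): [X,Y]=0\}$; equivalently, the flows commute: $Y_s\circ X_t=X_t\circ Y_s$ for all $s,t\in\mathbb{R}$. An invariant set $\Lambda$ is transitive if there is $x\in\Lambda$ whose forward orbit $\{X_t(x):t\ge 0\}$ is dense in $\Lambda$. A flow $(Y_t)_t$ preserves $\Lambda$ if $Y_t(\Lambda)=\Lambda$ for all $t$. A point $p$ is periodic if $X_t(p)=p$ for some $t>0$ and $\pi(p)=\inf\{t>0: X_t(p)=p\}>0$. A periodic point $p$ (or its orbit $\gamma_p=\{X_t(p):t\in\mathbb R\}$) is hyperbolic if $\gamma_p$ is a hyperbolic set: there is a $DX_t$-invariant splitting $T_{\gamma_p}M=E^s\oplus E^0\oplus E^u$, with $E^0$ one-dimensional and generated by $X$, and constants $C>0$, $\lambda\in(0,1)$ with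 $\|DX_t(x)|_{E^s_x}\|\le C\lambda^t$ and $\|(DX_t(x)|_{E^u_x})^{-1}\|\le C\lambda^t$ for all $x\in\gamma_p$, $t\ge 0$. "The set of hyperbolic periodic orbits is dense in $\Lambda$" means that the union of the hyperbolic periodic orbits contained in $\Lambda$ is dense in $\Lambda$. *)

theory Defs
  imports "HOL-Analysis.Analysis" "HOL-Library.Function_Algebras"
begin

text \<open>
  Functions into a real vector space form a real vector space under the pointwise operations.
  Tangent vectors are represented below as such functions.
\<close>

instantiation "fun" :: (type, real_vector) real_vector
begin

definition scaleR_fun :: "real \<Rightarrow> ('a \<Rightarrow> 'b) \<Rightarrow> 'a \<Rightarrow> 'b"
  where "scaleR_fun r f = (\<lambda>x. r *\<^sub>R f x)"

instance
  by standard (simp_all add: scaleR_fun_def fun_eq_iff scaleR_add_left scaleR_add_right)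

end

text \<open>Maps of class \<open>C\<^sup>k\<close>; the set \<open>S\<close> is always an open set below.\<close>

primrec Ck_on :: "nat \<Rightarrow> 'a::euclidean_space set \<Rightarrow> ('a \<Rightarrow> 'b::real_normed_vector) \<Rightarrow> bool"
  where
    "Ck_on 0 S f \<longleftrightarrow> continuous_on S f"
  | "Ck_on (Suc k) S f \<longleftrightarrow>
       (\<forall>x\<in>S. f differentiable (at x)) \<and> (\<forall>v. Ck_on k S (\<lambda>x. frechet_derivative f (at x) v))"

definition smooth_on :: "'a::euclidean_space set \<Rightarrow> ('a \<Rightarrow> 'b::real_normed_vector) \<Rightarrow> bool"
  where "smooth_on S f \<longleftrightarrow> (\<forall>k. Ck_on k S f)"

section \<open>Smooth manifolds without boundary\<close>

text \<open>
  The manifold is the whole type \<open>'m\<close>. A chart is an open set together with a map that is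
  relevant only on that set.
\<close>

type_synonym ('m, 'e) chart = "'m set \<times> ('m \<Rightarrow> 'e)"

abbreviation chart_dom :: "('m, 'e) chart \<Rightarrow> 'm set"
  where "chart_dom \<equiv> fst"

abbreviation chart_map :: "('m, 'e) chart \<Rightarrow> 'm \<Rightarrow> 'e"
  where "chart_map \<equiv> snd"

definition chart_inv :: "('m, 'e) chart \<Rightarrow> 'e \<Rightarrow> 'm"
  where "chart_inv c = inv_into (chart_dom c) (chart_map c)"

definition chart_ran :: "('m, 'e) chart \<Rightarrow> 'e set"
  where "chart_ran c = chart_map c ` chart_dom c"

text \<open>
  The atlas need not be maximal. Second countability is not demanded: it follows from
  compactness, which is assumed wherever it matters.
\<close>

definition smooth_atlas :: "('m::t2_space, 'e::euclidean_space) chart set \<Rightarrow> bool"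
  where "smooth_atlas A \<longleftrightarrow>
    (\<Union>c\<in>A. chart_dom c) = UNIV \<and>
    (\<forall>c\<in>A. open (chart_dom c) \<and> open (chart_ran c) \<and>
       homeomorphism (chart_dom c) (chart_ran c) (chart_map c) (chart_inv c)) \<and>
    (\<forall>c\<in>A. \<forall>d\<in>A.
       smooth_on (chart_map c ` (chart_dom c \<inter> chart_dom d)) (chart_map d \<circ> chart_inv c))"

definition charts_at :: "('m, 'e) chart set \<Rightarrow> 'm \<Rightarrow> ('m, 'e) chart set"
  where "charts_at A p = {c \<in> A. p \<in> chart_dom c}"

section \<open>Tangent vectors, vector fields, Riemannian metrics\<close>

text \<open>
  A tangent vector at \<open>p\<close> assigns to every chart around \<open>p\<close> its coordinate vector in that chart;
  the coordinate vectors are related by the derivatives of the transition maps. The value \<open>0\<close>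
  away from the charts around \<open>p\<close> makes the representation unique.
\<close>

type_synonym ('m, 'e) tvec = "('m, 'e) chart \<Rightarrow> 'e"

definition tangent_space ::
    "('m, 'e::euclidean_space) chart set \<Rightarrow> 'm \<Rightarrow> ('m, 'e) tvec set"
  where "tangent_space A p =
    {v. (\<forall>c\<in>charts_at A p. \<forall>d\<in>charts_at A p.
           v d = frechet_derivative (chart_map d \<circ> chart_inv c) (at (chart_map c p)) (v c)) \<and>
        (\<forall>c. c \<notin> charts_at A p \<longrightarrow> v c = 0)}"

text \<open>The tangent vector at \<open>p\<close> whose coordinate vector in the chart \<open>c\<close> is \<open>u\<close>.\<close>

definition coord_tvec ::
    "('m, 'e::euclidean_space) chart set \<Rightarrow> ('m, 'e) chart \<Rightarrow> 'm \<Rightarrow> 'e \<Rightarrow> ('m, 'e) tvec"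
  where "coord_tvec A c p u =
    (\<lambda>d. if d \<in> charts_at A p
         then frechet_derivative (chart_map d \<circ> chart_inv c) (at (chart_map c p)) u else 0)"

text \<open>The differential at \<open>p\<close> of a self-map of the manifold that is differentiable at \<open>p\<close>.\<close>

definition tangent_map ::
    "('m, 'e::euclidean_space) chart set \<Rightarrow> ('m \<Rightarrow> 'm) \<Rightarrow> 'm \<Rightarrow> ('m, 'e) tvec \<Rightarrow> ('m, 'e) tvec"
  where "tangent_map A f p v =
    (\<lambda>d. if d \<in> charts_at A (f p)
         then let c = (SOME c. c \<in> charts_at A p)
              in frechet_derivative (chart_map d \<circ> f \<circ> chart_inv c) (at (chart_map c p)) (v c)
         else 0)"

type_synonym ('m, 'e) vfield = "'m \<Rightarrow> ('m, 'e) tvec"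

definition local_rep :: "('m, 'e) vfield \<Rightarrow> ('m, 'e) chart \<Rightarrow> 'e \<Rightarrow> 'e"
  where "local_rep X c = (\<lambda>z. X (chart_inv c z) c)"

definition vector_fields ::
    "('m, 'e::euclidean_space) chart set \<Rightarrow> nat \<Rightarrow> ('m, 'e) vfield set"
  where "vector_fields A r =
    {X. (\<forall>p. X p \<in> tangent_space A p) \<and> (\<forall>c\<in>A. Ck_on r (chart_ran c) (local_rep X c))}"

text \<open>In coordinates \<open>[X, Y] = DY X - DX Y\<close>.\<close>

definition lie_bracket ::
    "('m, 'e::euclidean_space) chart set \<Rightarrow> ('m, 'e) vfield \<Rightarrow> ('m, 'e) vfield \<Rightarrow> ('m, 'e) vfield"
  where "lie_bracket A X Y p =
    (\<lambda>c. if c \<in> charts_at A p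
         then frechet_derivative (local_rep Y c) (at (chart_map c p)) (X p c)
            - frechet_derivative (local_rep X c) (at (chart_map c p)) (Y p c)
         else 0)"

definition centralizer ::
    "('m, 'e::euclidean_space) chart set \<Rightarrow> ('m, 'e) vfield \<Rightarrow> ('m, 'e) vfield set"
  where "centralizer A X = {Y \<in> vector_fields A 1. \<forall>p. lie_bracket A X Y p = 0}"

definition riemannian_metric ::
    "('m, 'e::euclidean_space) chart set \<Rightarrow> ('m \<Rightarrow> ('m, 'e) tvec \<Rightarrow> ('m, 'e) tvec \<Rightarrow> real) \<Rightarrow> bool"
  where "riemannian_metric A g \<longleftrightarrow>
    (\<forall>p. \<forall>u\<in>tangent_space A p. \<forall>v\<in>tangent_space A p. \<forall>w\<in>tangent_space A p. \<forall>a.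
       g p (u + v) w = g p u w + g p v w \<and>
       g p (a *\<^sub>R u) w = a * g p u w \<and>
       g p u v = g p v u \<and>
       (u \<noteq> 0 \<longrightarrow> g p u u > 0)) \<and>
    (\<forall>c\<in>A. \<forall>u v. smooth_on (chart_ran c)
       (\<lambda>z. g (chart_inv c z) (coord_tvec A c (chart_inv c z) u) (coord_tvec A c (chart_inv c z) v)))"

definition tnorm ::
    "('m \<Rightarrow> ('m, 'e) tvec \<Rightarrow> ('m, 'e) tvec \<Rightarrow> real) \<Rightarrow> 'm \<Rightarrow> ('m, 'e) tvec \<Rightarrow> real"
  where "tnorm g p v = sqrt (g p v v)"

section \<open>Flows\<close>

text \<open>
  Continuity of \<open>\<gamma>\<close> is part of the definition because the chart expressions are meaningful
  only while \<open>\<gamma>\<close> stays in the chart domain.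
\<close>

definition integral_curve ::
    "('m::t2_space, 'e::euclidean_space) chart set \<Rightarrow> ('m, 'e) vfield \<Rightarrow> (real \<Rightarrow> 'm) \<Rightarrow> bool"
  where "integral_curve A X \<gamma> \<longleftrightarrow>
    (\<forall>t. isCont \<gamma> t \<and>
         (\<forall>c\<in>charts_at A (\<gamma> t). ((chart_map c \<circ> \<gamma>) has_vector_derivative X (\<gamma> t) c) (at t)))"

definition flow_generated_by ::
    "('m::t2_space, 'e::euclidean_space) chart set \<Rightarrow> ('m, 'e) vfield \<Rightarrow> (real \<Rightarrow> 'm \<Rightarrow> 'm) \<Rightarrow> bool"
  where "flow_generated_by A X \<phi> \<longleftrightarrow>
    (\<forall>x. \<phi> 0 x = x \<and> integral_curve A X (\<lambda>t. \<phi> t x))"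

definition flow_preserves :: "(real \<Rightarrow> 'm \<Rightarrow> 'm) \<Rightarrow> 'm set \<Rightarrow> bool"
  where "flow_preserves \<phi> \<Lambda> \<longleftrightarrow> (\<forall>t. \<phi> t ` \<Lambda> = \<Lambda>)"

definition transitive_set :: "(real \<Rightarrow> 'm::t2_space \<Rightarrow> 'm) \<Rightarrow> 'm set \<Rightarrow> bool"
  where "transitive_set \<phi> \<Lambda> \<longleftrightarrow> (\<exists>x\<in>\<Lambda>. \<Lambda> \<subseteq> closure ((\<lambda>t. \<phi> t x) ` {0..}))"

definition flow_orbit :: "(real \<Rightarrow> 'm \<Rightarrow> 'm) \<Rightarrow> 'm \<Rightarrow> 'm set"
  where "flow_orbit \<phi> p = range (\<lambda>t. \<phi> t p)"

definition period :: "(real \<Rightarrow> 'm \<Rightarrow> 'm) \<Rightarrow> 'm \<Rightarrow> real"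
  where "period \<phi> p = Inf {t. t > 0 \<and> \<phi> t p = p}"

definition periodic_point :: "(real \<Rightarrow> 'm \<Rightarrow> 'm) \<Rightarrow> 'm \<Rightarrow> bool"
  where "periodic_point \<phi> p \<longleftrightarrow> (\<exists>t>0. \<phi> t p = p) \<and> period \<phi> p > 0"

section \<open>Hyperbolicity\<close>

definition direct_sum3 :: "'v::real_vector set \<Rightarrow> 'v set \<Rightarrow> 'v set \<Rightarrow> 'v set \<Rightarrow> bool"
  where "direct_sum3 V E F G \<longleftrightarrow>
    subspace E \<and> subspace F \<and> subspace G \<and> E \<subseteq> V \<and> F \<subseteq> V \<and> G \<subseteq> V \<and>
    (\<forall>v\<in>V. \<exists>!(a, b, c). a \<in> E \<and> b \<in> F \<and> c \<in> G \<and> v = a + b + c)"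

text \<open>
  The last estimate is the bound on the norm of the inverse of
  \<open>DX\<^sub>t : E\<^sup>u x \<rightarrow> E\<^sup>u (X\<^sub>t x)\<close>, evaluated at \<open>DX\<^sub>t v\<close>.
\<close>

definition hyperbolic_set ::
    "('m, 'e::euclidean_space) chart set \<Rightarrow> ('m \<Rightarrow> ('m, 'e) tvec \<Rightarrow> ('m, 'e) tvec \<Rightarrow> real) \<Rightarrow>
     ('m, 'e) vfield \<Rightarrow> (real \<Rightarrow> 'm \<Rightarrow> 'm) \<Rightarrow> 'm set \<Rightarrow> bool"
  where "hyperbolic_set A g X \<phi> K \<longleftrightarrow>
    (\<exists>Es E0 Eu. \<exists>C>0. \<exists>\<mu>>0. \<mu> < 1 \<and>
      (\<forall>x\<in>K.
         direct_sum3 (tangent_space A x) (Es x) (E0 x) (Eu x) \<and>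
         X x \<noteq> 0 \<and> E0 x = span {X x} \<and>
         (\<forall>t. tangent_map A (\<phi> t) x ` Es x = Es (\<phi> t x) \<and>
              tangent_map A (\<phi> t) x ` E0 x = E0 (\<phi> t x) \<and>
              tangent_map A (\<phi> t) x ` Eu x = Eu (\<phi> t x)) \<and>
         (\<forall>t\<ge>0. \<forall>v\<in>Es x.
            tnorm g (\<phi> t x) (tangent_map A (\<phi> t) x v) \<le> C * \<mu> powr t * tnorm g x v) \<and>
         (\<forall>t\<ge>0. \<forall>v\<in>Eu x.
            tnorm g x v \<le> C * \<mu> powr t * tnorm g (\<phi> t x) (tangent_map A (\<phi> t) x v))))"

definition hyperbolic_periodic_point ::
    "('m, 'e::euclidean_space) chart set \<Rightarrow> ('m \<Rightarrow> ('m, 'e) tvec \<Rightarrow> ('m, 'e) tvec \<Rightarrow> real) \<Rightarrow>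
     ('m, 'e) vfield \<Rightarrow> (real \<Rightarrow> 'm \<Rightarrow> 'm) \<Rightarrow> 'm \<Rightarrow> bool"
  where "hyperbolic_periodic_point A g X \<phi> p \<longleftrightarrow>
    periodic_point \<phi> p \<and> hyperbolic_set A g X \<phi> (flow_orbit \<phi> p)"

text \<open>The union of the hyperbolic periodic orbits contained in \<open>\<Lambda>\<close> is dense in \<open>\<Lambda>\<close>.\<close>

definition hyperbolic_periodic_orbits_dense ::
    "('m::t2_space, 'e::euclidean_space) chart set \<Rightarrow>
     ('m \<Rightarrow> ('m, 'e) tvec \<Rightarrow> ('m, 'e) tvec \<Rightarrow> real) \<Rightarrow>
     ('m, 'e) vfield \<Rightarrow> (real \<Rightarrow> 'm \<Rightarrow> 'm) \<Rightarrow> 'm set \<Rightarrow> bool"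
  where "hyperbolic_periodic_orbits_dense A g X \<phi> \<Lambda> \<longleftrightarrow>
    \<Lambda> \<subseteq> closure (\<Union> {flow_orbit \<phi> p | p.
           hyperbolic_periodic_point A g X \<phi> p \<and> flow_orbit \<phi> p \<subseteq> \<Lambda>})"

end

theory Submission
  imports Defs
begin

text \<open>
  Why the theorem holds. Let \<open>Y\<close> commute with \<open>X\<close>. In a chart the vanishing of the bracket reads
  \<open>DY X = DX Y\<close>, so along an orbit of \<open>X\<close> the field \<open>Y\<close> solves the linearised equation
  \<open>w' = DX w\<close>. The derivative of the flow in its initial point solves the same equation; hence
  \<open>DX\<^sub>t (Y p) = Y (X\<^sub>t p)\<close> for \<open>t \<ge> 0\<close> (\<open>flow_pushes_forward\<close>). Three consequences give the result.

  At a point \<open>q\<close> of a hyperbolic orbit with period \<open>T\<close> the vector \<open>Y q\<close> is fixed by every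
  \<open>DX\<^sub>n\<^sub>T q\<close>. These maps preserve the hyperbolic splitting, so the stable and the unstable
  component of \<open>Y q\<close> are fixed as well; contraction, respectively expansion, forces both to
  vanish, and \<open>Y q\<close> is a multiple of \<open>X q\<close>
  (\<open>commuting_field_on_hyperbolic_periodic_orbit\<close>).

  In a chart, proportionality of \<open>Y\<close> to a nonzero \<open>X\<close> is the closed condition
  \<open>(X \<bullet> X) Y = (X \<bullet> Y) X\<close>. It holds on a dense subset of \<open>\<Lambda>\<close>, hence at a point \<open>x0\<close> with dense
  forward orbit, where it says \<open>Y x0 = k X x0\<close> because \<open>X\<close> cannot vanish at \<open>x0\<close>. Pushing this
  forward by the flow gives \<open>Y = k X\<close> along the forward orbit of \<open>x0\<close>, and on \<open>\<Lambda>\<close> by continuity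
  (\<open>proportional_on_orbit_closure\<close>). In this way the singularities of \<open>X\<close> in \<open>\<Lambda>\<close> need no separate
  treatment, and one constant serves for all points.

  Finally \<open>t \<mapsto> X\<^sub>k\<^sub>t x\<close> stays in \<open>\<Lambda>\<close> for \<open>x \<in> \<Lambda>\<close> and is there an integral curve of \<open>Y\<close>; by
  uniqueness \<open>Y\<^sub>t = X\<^sub>k\<^sub>t\<close> on \<open>\<Lambda>\<close>, so the flow of \<open>Y\<close> preserves \<open>\<Lambda>\<close>.

  The analytic core is the differentiability of the flow in the initial point. No solution of the
  linearised equation is constructed for it: a Gronwall estimate shows that the displacement of
  orbits depends on the initial displacement linearly up to an error of smaller order, and such a
  map is differentiable because its difference quotients are Cauchy
  (\<open>differentiable_if_asymptotically_linear\<close>).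
\<close>

section \<open>A Gronwall estimate and a criterion for differentiability\<close>

text \<open>
  The constant \<open>c\<close> is treated as a further, constant component: the vector \<open>(u, c)\<close> grows at most
  at the rate \<open>K + 1\<close>, so \<open>(\<parallel>u\<parallel>\<^sup>2 + c\<^sup>2) exp (-2 (K + 1) t)\<close> does not increase. This avoids integrals,
  at the price of the rate \<open>K + 1\<close> in place of \<open>K\<close>, which is immaterial below.
\<close>

lemma gronwall_affine:
  fixes u :: "real \<Rightarrow> 'a::real_inner"
  assumes der: "\<And>t. 0 \<le> t \<Longrightarrow> t \<le> s \<Longrightarrow> (u has_vector_derivative u' t) (at t)"
    and bound: "\<And>t. 0 \<le> t \<Longrightarrow> t \<le> s \<Longrightarrow> norm (u' t) \<le> K * norm (u t) + c"
    and "0 \<le> K" "0 \<le> c" "0 \<le> t" "t \<le> s"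
  shows "norm (u t) \<le> (norm (u 0) + c) * exp ((K + 1) * t)"
proof -
  define F where "F = (\<lambda>t. ((norm (u t))\<^sup>2 + c\<^sup>2) * exp (- 2 * (K + 1) * t))"
  have "F t \<le> F 0"
  proof (rule DERIV_nonpos_imp_nonincreasing[OF \<open>0 \<le> t\<close>])
    fix x assume x: "0 \<le> x" "x \<le> t"
    with assms have xs: "x \<le> s" by simp
    note d = der[OF x(1) xs]
    have "((\<lambda>t. u t \<bullet> u t) has_vector_derivative 2 * (u x \<bullet> u' x)) (at x)"
      by (rule has_vector_derivative_eq_rhs[OF bounded_bilinear.has_vector_derivative[OF bounded_bilinear_inner d d]])
        (simp add: inner_commute)
    then have n: "((\<lambda>t. (norm (u t))\<^sup>2) has_real_derivative 2 * (u x \<bullet> u' x)) (at x)"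
      by (simp add: power2_norm_eq_inner has_real_derivative_iff_has_vector_derivative)
    define N where "N = norm (u x)"
    let ?E = "exp (- 2 * (K + 1) * x)"
    have "(F has_real_derivative
        (2 * (u x \<bullet> u' x) - 2 * (K + 1) * (N\<^sup>2 + c\<^sup>2)) * ?E) (at x)"
      unfolding F_def N_def by (rule derivative_eq_intros n refl | simp add: algebra_simps)+
    moreover have "2 * (u x \<bullet> u' x) - 2 * (K + 1) * (N\<^sup>2 + c\<^sup>2) \<le> 0"
    proof -
      have K: "0 \<le> K * N + c"
        using bound[OF x(1) xs] norm_ge_zero[of "u' x"] unfolding N_def by linarith
      have "u x \<bullet> u' x \<le> N * norm (u' x)" unfolding N_def by (rule norm_cauchy_schwarz)
      also have "\<dots> \<le> N * (K * N + c)"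
        unfolding N_def by (intro mult_left_mono bound x xs) auto
      finally have 1: "u x \<bullet> u' x \<le> K * N\<^sup>2 + c * N" by (simp add: algebra_simps power2_eq_square)
      have 2: "2 * (c * N) \<le> N\<^sup>2 + c\<^sup>2" 
        using sum_squares_bound[of c N] by (simp add: algebra_simps)
      have "0 \<le> K * c\<^sup>2" using \<open>0 \<le> K\<close> by simp
      moreover have "2 * (K + 1) * (N\<^sup>2 + c\<^sup>2) = 2 * (K * N\<^sup>2) + 2 * (K * c\<^sup>2) + 2 * N\<^sup>2 + 2 * c\<^sup>2"
        by (simp add: algebra_simps)
      ultimately show ?thesis
        using 1 2 zero_le_power2[of N] zero_le_power2[of c] by linarith
    qed
    ultimately show "\<exists>y. (F has_real_derivative y) (at x) \<and> y \<le> 0"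
      by (meson exp_ge_zero mult_nonpos_nonneg)
  qed
  then have "(norm (u t))\<^sup>2 + c\<^sup>2 \<le> ((norm (u 0))\<^sup>2 + c\<^sup>2) * exp (2 * (K + 1) * t)"
    by (simp add: F_def exp_minus field_simps exp_diff exp_add)
  also have "\<dots> \<le> (norm (u 0) + c)\<^sup>2 * exp (2 * (K + 1) * t)"
    using \<open>0 \<le> c\<close> by (intro mult_right_mono) (auto simp: power2_sum)
  also have "\<dots> = ((norm (u 0) + c) * exp ((K + 1) * t))\<^sup>2"
    by (simp add: power_mult_distrib exp_double[symmetric] mult.assoc)
  finally have "(norm (u t))\<^sup>2 \<le> ((norm (u 0) + c) * exp ((K + 1) * t))\<^sup>2"
    using zero_le_power2[of c] by linarith
  then show ?thesis
    by (rule power2_le_imp_le) (use \<open>0 \<le> c\<close> in auto)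
qed


text \<open>
  Applied to multiples of one vector, the hypothesis makes the difference quotients
  \<open>n R (v / n)\<close> Cauchy; their limit is linear in \<open>v\<close>, and the estimate passes to the limit. The
  derivative thus need not be known in advance.
\<close>

lemma differentiable_if_asymptotically_linear:
  fixes R :: "'a::euclidean_space \<Rightarrow> 'b::banach"
  assumes lin: "\<And>e. e > 0 \<Longrightarrow> \<exists>d>0. \<forall>a b \<alpha>. norm a < d \<longrightarrow> norm b < d \<longrightarrow> norm (a + \<alpha> *\<^sub>R b) < d \<longrightarrow>
      norm (R (a + \<alpha> *\<^sub>R b) - R a - \<alpha> *\<^sub>R R b) \<le> e * (norm a + \<bar>\<alpha>\<bar> * norm b)"
  shows "\<exists>L. (R has_derivative L) (at 0)"
proof -
  define Q where "Q v n = real (Suc n) *\<^sub>R R ((1 / real (Suc n)) *\<^sub>R v)" for v n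
  have R0: "R 0 = 0"
  proof -
    obtain d where "d > 0" and d: "\<And>a b \<alpha>. norm a < d \<Longrightarrow> norm b < d \<Longrightarrow> norm (a + \<alpha> *\<^sub>R b) < d \<Longrightarrow>
      norm (R (a + \<alpha> *\<^sub>R b) - R a - \<alpha> *\<^sub>R R b) \<le> 1 * (norm a + \<bar>\<alpha>\<bar> * norm b)"
      using lin[of 1] by auto
    show ?thesis using d[of 0 0 1] \<open>d > 0\<close> by simp
  qed
  have small: "\<forall>\<^sub>F n in sequentially. norm ((1 / real (Suc n)) *\<^sub>R v) < d" if "d > 0" for d and v :: 'a
  proof -
    have "(\<lambda>n. norm ((1 / real (Suc n)) *\<^sub>R v)) \<longlonglongrightarrow> norm (0 *\<^sub>R v)"
      unfolding inverse_eq_divide[symmetric]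
      by (intro tendsto_intros LIMSEQ_inverse_real_of_nat)
    from order_tendstoD(2)[OF this] that show ?thesis by simp
  qed
  have Cau: "norm (Q v n - Q v m) \<le> e * norm v"
    if d: "\<And>a b \<alpha>. norm a < d \<Longrightarrow> norm b < d \<Longrightarrow> norm (a + \<alpha> *\<^sub>R b) < d \<Longrightarrow>
      norm (R (a + \<alpha> *\<^sub>R b) - R a - \<alpha> *\<^sub>R R b) \<le> e * (norm a + \<bar>\<alpha>\<bar> * norm b)"
      and "d > 0" "norm ((1 / real (Suc n)) *\<^sub>R v) < d" "norm ((1 / real (Suc m)) *\<^sub>R v) < d"
    for v d e n m
  proof -
    let ?n = "real (Suc n)" and ?m = "real (Suc m)"
    \<comment> \<open>The vector \<open>v / n\<close> is the multiple \<open>m / n\<close> of \<open>v / m\<close>; now use the hypothesis with \<open>a = 0\<close>.\<close>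
    have "norm (R ((1 / ?n) *\<^sub>R v) - (?m / ?n) *\<^sub>R R ((1 / ?m) *\<^sub>R v)) \<le> e * ((?m / ?n) * norm ((1 / ?m) *\<^sub>R v))"
      using d[of 0 "(1 / ?m) *\<^sub>R v" "?m / ?n"] that(2-) by (simp add: R0)
    then have "?n * norm (R ((1 / ?n) *\<^sub>R v) - (?m / ?n) *\<^sub>R R ((1 / ?m) *\<^sub>R v)) \<le> ?n * (e * ((?m / ?n) * norm ((1 / ?m) *\<^sub>R v)))"
      by (rule mult_left_mono) simp
    also have "\<dots> = e * norm v" by simp
    also have "?n * norm (R ((1 / ?n) *\<^sub>R v) - (?m / ?n) *\<^sub>R R ((1 / ?m) *\<^sub>R v)) =
        norm (?n *\<^sub>R (R ((1 / ?n) *\<^sub>R v) - (?m / ?n) *\<^sub>R R ((1 / ?m) *\<^sub>R v)))"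
      by simp
    also have "?n *\<^sub>R (R ((1 / ?n) *\<^sub>R v) - (?m / ?n) *\<^sub>R R ((1 / ?m) *\<^sub>R v)) = Q v n - Q v m"
      by (simp add: Q_def scaleR_diff_right)
    finally show ?thesis .
  qed
  have "\<exists>l. Q v \<longlonglongrightarrow> l" for v
  proof -
    have "Cauchy (Q v)"
    proof (rule metric_CauchyI)
      fix e :: real assume "e > 0"
      define e' where "e' = e / (2 * (norm v + 1))"
      have "e' > 0" "e' * norm v < e"
        using \<open>e > 0\<close> norm_ge_zero[of v] by (auto simp: e'_def field_simps add_pos_nonneg intro: add_nonneg_pos)
      obtain d where "d > 0" and d: "\<And>a b \<alpha>. norm a < d \<Longrightarrow> norm b < d \<Longrightarrow> norm (a + \<alpha> *\<^sub>R b) < d \<Longrightarrow>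
        norm (R (a + \<alpha> *\<^sub>R b) - R a - \<alpha> *\<^sub>R R b) \<le> e' * (norm a + \<bar>\<alpha>\<bar> * norm b)"
        using lin[OF \<open>e' > 0\<close>] by auto
      obtain N where "\<And>n. n \<ge> N \<Longrightarrow> norm ((1 / real (Suc n)) *\<^sub>R v) < d"
        using small[OF \<open>d > 0\<close>, of v] unfolding eventually_sequentially by blast
      then have "dist (Q v m) (Q v n) < e" if "m \<ge> N" "n \<ge> N" for m n
        using Cau[OF d \<open>d > 0\<close>, where v = v] that \<open>e' * norm v < e\<close> unfolding dist_norm
        by (meson le_less_trans)
      then show "\<exists>M. \<forall>m\<ge>M. \<forall>n\<ge>M. dist (Q v m) (Q v n) < e" by blast
    qed
    then show ?thesis using Cauchy_convergent convergent_def by blast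
  qed
  then obtain L where L: "\<And>v. Q v \<longlonglongrightarrow> L v" by metis
  have comb: "L (u + \<alpha> *\<^sub>R v) = L u + \<alpha> *\<^sub>R L v" for u v \<alpha>
  proof -
    have "(\<lambda>n. Q (u + \<alpha> *\<^sub>R v) n - Q u n - \<alpha> *\<^sub>R Q v n) \<longlonglongrightarrow> 0"
    proof (rule metric_LIMSEQ_I)
      fix e :: real assume "e > 0"
      define S where "S = norm u + \<bar>\<alpha>\<bar> * norm v"
      have "S \<ge> 0" by (simp add: S_def)
      define e' where "e' = e / (2 * (S + 1))"
      have "e' > 0" "e' * S < e"
        using \<open>e > 0\<close> \<open>S \<ge> 0\<close> by (auto simp: e'_def field_simps add_pos_nonneg intro: add_nonneg_pos)
      obtain d where "d > 0" and d: "\<And>a b \<alpha>. norm a < d \<Longrightarrow> norm b < d \<Longrightarrow> norm (a + \<alpha> *\<^sub>R b) < d \<Longrightarrow>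
        norm (R (a + \<alpha> *\<^sub>R b) - R a - \<alpha> *\<^sub>R R b) \<le> e' * (norm a + \<bar>\<alpha>\<bar> * norm b)"
        using lin[OF \<open>e' > 0\<close>] by auto
      have "\<forall>\<^sub>F n in sequentially. norm ((1 / real (Suc n)) *\<^sub>R u) < d \<and> norm ((1 / real (Suc n)) *\<^sub>R v) < d
          \<and> norm ((1 / real (Suc n)) *\<^sub>R (u + \<alpha> *\<^sub>R v)) < d"
        by (intro eventually_conj small \<open>d > 0\<close>)
      then obtain N where N: "\<And>n. n \<ge> N \<Longrightarrow> norm ((1 / real (Suc n)) *\<^sub>R u) < d \<and> norm ((1 / real (Suc n)) *\<^sub>R v) < d
          \<and> norm ((1 / real (Suc n)) *\<^sub>R (u + \<alpha> *\<^sub>R v)) < d"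
        unfolding eventually_sequentially by blast
      have "norm (Q (u + \<alpha> *\<^sub>R v) n - Q u n - \<alpha> *\<^sub>R Q v n) < e" if "n \<ge> N" for n
      proof -
        let ?n = "real (Suc n)"
        let ?D = "R ((1 / ?n) *\<^sub>R u + \<alpha> *\<^sub>R (1 / ?n) *\<^sub>R v) - R ((1 / ?n) *\<^sub>R u) - \<alpha> *\<^sub>R R ((1 / ?n) *\<^sub>R v)"
        have eq: "(1 / ?n) *\<^sub>R u + \<alpha> *\<^sub>R (1 / ?n) *\<^sub>R v = (1 / ?n) *\<^sub>R (u + \<alpha> *\<^sub>R v)"
          by (simp add: scaleR_add_right)
        have "norm ?D \<le> e' * (norm ((1 / ?n) *\<^sub>R u) + \<bar>\<alpha>\<bar> * norm ((1 / ?n) *\<^sub>R v))"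
          using N[OF that] by (intro d) (simp_all add: eq del: scaleR_scaleR of_nat_Suc)
        also have "\<dots> = (1 / ?n) * (e' * S)" by (simp add: S_def algebra_simps add_divide_distrib del: of_nat_Suc)
        finally have "?n * norm ?D \<le> ?n * ((1 / ?n) * (e' * S))" by (rule mult_left_mono) simp
        also have "\<dots> = e' * S" by simp
        also have "?n * norm ?D = norm (?n *\<^sub>R ?D)" by simp
        also have "?n *\<^sub>R ?D = Q (u + \<alpha> *\<^sub>R v) n - Q u n - \<alpha> *\<^sub>R Q v n"
          unfolding Q_def eq by (simp add: scaleR_diff_right mult.commute del: of_nat_Suc)
        finally show ?thesis using \<open>e' * S < e\<close> by linarith
      qed
      then show "\<exists>no. \<forall>n\<ge>no. dist (Q (u + \<alpha> *\<^sub>R v) n - Q u n - \<alpha> *\<^sub>R Q v n) 0 < e"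
        by auto
    qed
    moreover have "(\<lambda>n. Q (u + \<alpha> *\<^sub>R v) n - Q u n - \<alpha> *\<^sub>R Q v n) \<longlonglongrightarrow> L (u + \<alpha> *\<^sub>R v) - L u - \<alpha> *\<^sub>R L v"
      by (intro tendsto_intros L)
    ultimately have "L (u + \<alpha> *\<^sub>R v) - L u - \<alpha> *\<^sub>R L v = 0" using LIMSEQ_unique by blast
    then show ?thesis by (simp add: algebra_simps)
  qed
  have L0: "L 0 = 0"
  proof -
    have "Q 0 = (\<lambda>n. 0)" by (simp add: Q_def R0 fun_eq_iff)
    then show ?thesis using L[of 0] by (simp add: LIMSEQ_const_iff)
  qed
  have "linear L"
    using comb[of _ 1] comb[of 0] by (intro linearI) (simp_all add: L0)
  then have "bounded_linear L" by (simp add: linear_conv_bounded_linear)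
  moreover have "\<exists>d>0. \<forall>y. norm (y - 0) < d \<longrightarrow> norm (R y - R 0 - L (y - 0)) \<le> e * norm (y - 0)" if e: "e > 0" for e
  proof -
    obtain d where "d > 0" and d: "\<And>a b \<alpha>. norm a < d \<Longrightarrow> norm b < d \<Longrightarrow> norm (a + \<alpha> *\<^sub>R b) < d \<Longrightarrow>
        norm (R (a + \<alpha> *\<^sub>R b) - R a - \<alpha> *\<^sub>R R b) \<le> e * (norm a + \<bar>\<alpha>\<bar> * norm b)"
      using lin[OF e] by auto
    have "norm (R y - L y) \<le> e * norm y" if y: "norm y < d" for y
    proof -
      have "(\<lambda>n. norm (Q y 0 - Q y n)) \<longlonglongrightarrow> norm (Q y 0 - L y)" by (intro tendsto_intros L)
      moreover have "\<forall>\<^sub>F n in sequentially. norm (Q y 0 - Q y n) \<le> e * norm y"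
        using small[OF \<open>d > 0\<close>, of y]
        by eventually_elim (use Cau[OF d \<open>d > 0\<close>, of 0 y] y in simp)
      ultimately have "norm (Q y 0 - L y) \<le> e * norm y"
        by (rule tendsto_upperbound) simp
      then show ?thesis by (simp add: Q_def)
    qed
    then show ?thesis using \<open>d > 0\<close> by (auto simp: R0)
  qed
  ultimately show ?thesis unfolding has_derivative_at_alt by blast
qed

section \<open>Differentiability of flows in Euclidean space\<close>

lemma Ck_on_continuous: "Ck_on k S f \<Longrightarrow> continuous_on S f"
  by (cases k)
    (auto intro!: continuous_at_imp_continuous_on differentiable_imp_continuous_within)

lemma Ck_on_1_mono: "Ck_on r S f \<Longrightarrow> r \<ge> 1 \<Longrightarrow> Ck_on 1 S f"
  by (cases r) (auto intro: Ck_on_continuous)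

lemma norm_linear_le_sum_Basis:
  fixes g :: "'a::euclidean_space \<Rightarrow> 'b::real_normed_vector"
  assumes "linear g"
  shows "norm (g v) \<le> (\<Sum>b\<in>Basis. norm (g b)) * norm v"
proof -
  have "g v = g (\<Sum>b\<in>Basis. (v \<bullet> b) *\<^sub>R b)" by (simp add: euclidean_representation)
  also have "\<dots> = (\<Sum>b\<in>Basis. (v \<bullet> b) *\<^sub>R g b)"
    using assms by (simp add: linear_sum linear_scale)
  finally have eq: "g v = (\<Sum>b\<in>Basis. (v \<bullet> b) *\<^sub>R g b)" .
  have "norm (g v) \<le> (\<Sum>b\<in>Basis. norm ((v \<bullet> b) *\<^sub>R g b))" by (subst eq) (rule norm_sum)
  also have "\<dots> \<le> (\<Sum>b\<in>Basis. norm v * norm (g b))"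
    by (intro sum_mono) (simp add: mult_right_mono Basis_le_norm)
  finally show ?thesis by (simp add: sum_distrib_left mult.commute)
qed

text \<open>
  On a compact set the continuous partial derivatives are bounded and uniformly continuous;
  convexity carries both properties over to increments of \<open>f\<close> by the mean value inequality.
\<close>

lemma C1_uniform_bounds:
  fixes f :: "'a::euclidean_space \<Rightarrow> 'b::real_normed_vector"
  assumes C1: "Ck_on 1 U f" and "B \<subseteq> U" "compact B" "convex B"
  obtains K where "K \<ge> 0"
    "\<And>x v. x \<in> B \<Longrightarrow> norm (frechet_derivative f (at x) v) \<le> K * norm v"
    "\<And>x y. x \<in> B \<Longrightarrow> y \<in> B \<Longrightarrow> norm (f x - f y) \<le> K * norm (x - y)"
    "\<And>e. e > 0 \<Longrightarrow> \<exists>d>0. \<forall>x\<in>B. \<forall>y\<in>B. norm (y - x) < d \<longrightarrow>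
        norm (f y - f x - frechet_derivative f (at x) (y - x)) \<le> e * norm (y - x)"
proof -
  let ?D = "\<lambda>x. frechet_derivative f (at x)"
  have der: "(f has_derivative ?D x) (at x)" if "x \<in> B" for x
    using C1 \<open>B \<subseteq> U\<close> that frechet_derivative_works by auto
  have lin: "linear (?D x)" if "x \<in> B" for x
    using der[OF that] by (rule has_derivative_linear)
  have cont: "continuous_on B (\<lambda>x. ?D x b)" for b
    using C1 by (intro continuous_on_subset[OF _ \<open>B \<subseteq> U\<close>]) simp
  have "\<exists>M. \<forall>x\<in>B. norm (?D x b) \<le> M" for b
    using compact_imp_bounded[OF compact_continuous_image[OF cont \<open>compact B\<close>, of b]]
    unfolding bounded_iff by auto
  then obtain M where M: "\<And>b x. x \<in> B \<Longrightarrow> norm (?D x b) \<le> M b" by metis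
  define K where "K = (\<Sum>b\<in>Basis. \<bar>M b\<bar>)"
  have K0: "K \<ge> 0" unfolding K_def by (intro sum_nonneg) auto
  have bound: "norm (?D x v) \<le> K * norm v" if "x \<in> B" for x v
  proof -
    have "norm (?D x v) \<le> (\<Sum>b\<in>Basis. norm (?D x b)) * norm v"
      by (rule norm_linear_le_sum_Basis[OF lin[OF that]])
    also have "\<dots> \<le> K * norm v"
      unfolding K_def
      by (intro mult_right_mono sum_mono) (auto intro: order_trans[OF M[OF that]])
    finally show ?thesis .
  qed
  have lip: "norm (f x - f y) \<le> K * norm (x - y)" if "x \<in> B" "y \<in> B" for x y
    by (rule differentiable_bound[OF \<open>convex B\<close> has_derivative_at_withinI[OF der] _ that])
      (auto intro: onorm_bound K0 bound)
  have unif: "\<exists>d>0. \<forall>x\<in>B. \<forall>y\<in>B. norm (y - x) < d \<longrightarrow>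
        norm (f y - f x - ?D x (y - x)) \<le> e * norm (y - x)" if "e > 0" for e
  proof -
    define e' where "e' = e / real DIM('a)"
    have "e' > 0" using that by (simp add: e'_def)
    have "\<exists>d>0. \<forall>x\<in>B. \<forall>y\<in>B. norm (y - x) < d \<longrightarrow> norm (?D y b - ?D x b) \<le> e'" for b
      using compact_uniformly_continuous[OF cont \<open>compact B\<close>, of b] \<open>e' > 0\<close>
      unfolding uniformly_continuous_on_def dist_norm by (meson less_imp_le)
    then obtain d where d: "\<And>b. d b > 0"
      "\<And>b x y. x \<in> B \<Longrightarrow> y \<in> B \<Longrightarrow> norm (y - x) < d b \<Longrightarrow> norm (?D y b - ?D x b) \<le> e'"
      by metis
    define \<delta> where "\<delta> = Min (d ` Basis)"
    have "\<delta> > 0" using d(1) by (simp add: \<delta>_def)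
    moreover have "norm (f y - f x - ?D x (y - x)) \<le> e * norm (y - x)"
      if xy: "x \<in> B" "y \<in> B" "norm (y - x) < \<delta>" for x y
    proof -
      let ?S = "closed_segment x y"
      have S: "?S \<subseteq> B" using \<open>convex B\<close> xy by (simp add: closed_segment_subset)
      have "norm (f y - f x - ?D x (y - x)) \<le> norm (y - x) * e"
      proof (rule differentiable_bound_linearization[where S = ?S])
        show "x + t *\<^sub>R (y - x) \<in> ?S" if "t \<in> {0..1}" for t
          using that by (auto simp: closed_segment_def algebra_simps intro!: exI[of _ t])
        show "(f has_derivative ?D z) (at z within ?S)" if "z \<in> ?S" for z
          using der S that by (blast intro: has_derivative_at_withinI)
        show "x \<in> ?S" by simp
        show "onorm (?D z - ?D x) \<le> e" if z: "z \<in> ?S" for z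
        proof (rule onorm_bound)
          fix v
          have "z \<in> B" using z S by auto
          have "norm (z - x) < \<delta>"
            using segment_bound(1)[OF z] xy(3) by (simp add: norm_minus_commute)
          then have le: "norm (?D z b - ?D x b) \<le> e'" if "b \<in> Basis" for b
            using that by (intro d(2) xy \<open>z \<in> B\<close>) (simp add: \<delta>_def)
          have "norm ((?D z - ?D x) v) \<le> (\<Sum>b\<in>Basis. norm (?D z b - ?D x b)) * norm v"
            using norm_linear_le_sum_Basis[OF linear_compose_sub[OF lin[OF \<open>z \<in> B\<close>] lin[OF xy(1)]], of v]
            by simp
          also have "\<dots> \<le> (\<Sum>b\<in>(Basis :: 'a set). e') * norm v"
            by (intro mult_right_mono sum_mono le) auto
          also have "\<dots> = e * norm v" by (simp add: e'_def)
          finally show "norm ((?D z - ?D x) v) \<le> e * norm v" .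
        qed (use \<open>e > 0\<close> in simp)
      qed
      then show ?thesis by (simp add: mult.commute)
    qed
    ultimately show ?thesis by blast
  qed
  show ?thesis using that[OF K0 bound lip unif] .
qed

text \<open>
  Let \<open>R a\<close> be the displacement of the orbit when the initial point is moved by \<open>a\<close>. It solves
  the linearised equation up to an error of order \<open>o (\<parallel>a\<parallel>)\<close>, uniformly in time. So do linear
  combinations of displacements, and Gronwall turns this into asymptotic linearity of \<open>a \<mapsto> R a s\<close>.
  Comparing \<open>R (h y\<^sub>0)\<close> with \<open>h y\<close> for a solution \<open>y\<close> of the linearised equation identifies the
  derivative in the direction \<open>y\<^sub>0\<close>.
\<close>

lemma flow_differentiable_euclidean:
  fixes f :: "'a::euclidean_space \<Rightarrow> 'a"
  assumes "0 \<le> K" "0 \<le> s" "0 < \<rho>"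
    and lin: "\<And>x. x \<in> B \<Longrightarrow> linear (Df x)"
    and bound: "\<And>x v. x \<in> B \<Longrightarrow> norm (Df x v) \<le> K * norm v"
    and lip: "\<And>x y. x \<in> B \<Longrightarrow> y \<in> B \<Longrightarrow> norm (f x - f y) \<le> K * norm (x - y)"
    and unif: "\<And>e. e > 0 \<Longrightarrow> \<exists>d>0. \<forall>x\<in>B. \<forall>y\<in>B. norm (y - x) < d \<longrightarrow>
        norm (f y - f x - Df x (y - x)) \<le> e * norm (y - x)"
    and stay: "\<And>z t. z \<in> ball z0 \<rho> \<Longrightarrow> 0 \<le> t \<Longrightarrow> t \<le> s \<Longrightarrow> \<Phi> t z \<in> B"
    and der: "\<And>z t. z \<in> ball z0 \<rho> \<Longrightarrow> 0 \<le> t \<Longrightarrow> t \<le> s \<Longrightarrow>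
        ((\<lambda>t. \<Phi> t z) has_vector_derivative f (\<Phi> t z)) (at t)"
    and init: "\<And>z. z \<in> ball z0 \<rho> \<Longrightarrow> \<Phi> 0 z = z"
  shows "\<exists>L. (\<Phi> s has_derivative L) (at z0) \<and>
    (\<forall>y. (\<forall>t. 0 \<le> t \<longrightarrow> t \<le> s \<longrightarrow> (y has_vector_derivative Df (\<Phi> t z0) (y t)) (at t)) \<longrightarrow> L (y 0) = y s)"
proof -
  define R where "R a t = \<Phi> t (z0 + a) - \<Phi> t z0" for a t
  define C where "C = exp ((K + 1) * s)"
  have "C > 0" by (simp add: C_def)
  have z0: "z0 \<in> ball z0 \<rho>" using \<open>0 < \<rho>\<close> by simp
  have inb: "z0 + a \<in> ball z0 \<rho>" if "norm a < \<rho>" for a using that by (simp add: dist_norm)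
  have Rder: "(R a has_vector_derivative f (\<Phi> t (z0 + a)) - f (\<Phi> t z0)) (at t)"
    if "norm a < \<rho>" "0 \<le> t" "t \<le> s" for a t
    unfolding R_def using that by (intro has_vector_derivative_diff der inb z0)
  have R_init: "R a 0 = a" if "norm a < \<rho>" for a
    using init[OF inb[OF that]] init[OF z0] by (simp add: R_def)
  have expC: "exp ((K + 1) * t) \<le> C" if "t \<le> s" for t
    unfolding C_def using that \<open>0 \<le> K\<close> by (simp add: mult_left_mono)
  have Rbound: "norm (R a t) \<le> C * norm a" if a: "norm a < \<rho>" and t: "0 \<le> t" "t \<le> s" for a t
  proof -
    have "norm (R a t) \<le> (norm (R a 0) + 0) * exp ((K + 1) * t)"
    proof (rule gronwall_affine[OF Rder[OF a] _ \<open>0 \<le> K\<close> order_refl t])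
      fix t assume "0 \<le> t" "t \<le> s"
      then show "norm (f (\<Phi> t (z0 + a)) - f (\<Phi> t z0)) \<le> K * norm (R a t) + 0"
        using lip[OF stay stay] inb[OF a] z0 by (simp add: R_def)
    qed
    also have "\<dots> \<le> norm a * C"
      by (simp add: R_init[OF a] mult_left_mono expC t)
    finally show ?thesis by (simp add: mult.commute)
  qed
  have key: "\<exists>d>0. d \<le> \<rho> \<and> (\<forall>a t. norm a < d \<longrightarrow> 0 \<le> t \<longrightarrow> t \<le> s \<longrightarrow>
      norm (f (\<Phi> t (z0 + a)) - f (\<Phi> t z0) - Df (\<Phi> t z0) (R a t)) \<le> e * norm a)" if "e > 0" for e
  proof -
    obtain d' where "d' > 0" and d': "\<And>x y. x \<in> B \<Longrightarrow> y \<in> B \<Longrightarrow> norm (y - x) < d' \<Longrightarrow>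
        norm (f y - f x - Df x (y - x)) \<le> e / C * norm (y - x)"
      using unif[of "e / C"] \<open>e > 0\<close> \<open>C > 0\<close> by auto
    define d where "d = min \<rho> (d' / C)"
    have "d > 0" using \<open>0 < \<rho>\<close> \<open>d' > 0\<close> \<open>C > 0\<close> by (simp add: d_def)
    moreover have "norm (f (\<Phi> t (z0 + a)) - f (\<Phi> t z0) - Df (\<Phi> t z0) (R a t)) \<le> e * norm a"
      if a: "norm a < d" and t: "0 \<le> t" "t \<le> s" for a t
    proof -
      have a\<rho>: "norm a < \<rho>" using a by (simp add: d_def)
      have "norm a < d' / C" using a by (simp add: d_def)
      then have "C * norm a < d'" using \<open>C > 0\<close> by (simp add: field_simps)
      then have "norm (\<Phi> t (z0 + a) - \<Phi> t z0) < d'"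
        using Rbound[OF a\<rho> t] by (simp add: R_def)
      then have "norm (f (\<Phi> t (z0 + a)) - f (\<Phi> t z0) - Df (\<Phi> t z0) (R a t)) \<le> e / C * norm (R a t)"
        unfolding R_def by (intro d' stay inb a\<rho> z0 t)
      also have "\<dots> \<le> e / C * (C * norm a)"
        using \<open>e > 0\<close> \<open>C > 0\<close> by (intro mult_left_mono Rbound a\<rho> t) auto
      also have "\<dots> = e * norm a" using \<open>C > 0\<close> by simp
      finally show ?thesis .
    qed
    ultimately show ?thesis by (intro exI[of _ d]) (auto simp: d_def)
  qed
  have "\<exists>L. ((\<lambda>a. R a s) has_derivative L) (at 0)"
  proof (rule differentiable_if_asymptotically_linear)
    fix e :: real assume "e > 0"
    define e' where "e' = e / (2 * C)"
    have "e' > 0" using \<open>e > 0\<close> \<open>C > 0\<close> by (simp add: e'_def)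
    obtain d where d0: "d > 0" "d \<le> \<rho>" and d: "\<And>a t. norm a < d \<Longrightarrow> 0 \<le> t \<Longrightarrow> t \<le> s \<Longrightarrow>
      norm (f (\<Phi> t (z0 + a)) - f (\<Phi> t z0) - Df (\<Phi> t z0) (R a t)) \<le> e' * norm a"
      using key[OF \<open>e' > 0\<close>] by blast
    have "norm (R (a + \<alpha> *\<^sub>R b) s - R a s - \<alpha> *\<^sub>R R b s) \<le> e * (norm a + \<bar>\<alpha>\<bar> * norm b)"
      if a: "norm a < d" and b: "norm b < d" and ab: "norm (a + \<alpha> *\<^sub>R b) < d" for a b \<alpha>
    proof -
      define u where "u t = R (a + \<alpha> *\<^sub>R b) t - R a t - \<alpha> *\<^sub>R R b t" for t
      define F where "F a t = f (\<Phi> t (z0 + a)) - f (\<Phi> t z0)" for a t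
      define S where "S = norm a + \<bar>\<alpha>\<bar> * norm b"
      have \<rho>: "norm a < \<rho>" "norm b < \<rho>" "norm (a + \<alpha> *\<^sub>R b) < \<rho>" using a b ab d0 by linarith+
      have "norm (u s) \<le> (norm (u 0) + 2 * e' * S) * exp ((K + 1) * s)"
      proof (rule gronwall_affine[OF _ _ \<open>0 \<le> K\<close> _ \<open>0 \<le> s\<close> order_refl,
            where u' = "\<lambda>t. F (a + \<alpha> *\<^sub>R b) t - F a t - \<alpha> *\<^sub>R F b t"])
        fix t assume t: "0 \<le> t" "t \<le> s"
        show "(u has_vector_derivative F (a + \<alpha> *\<^sub>R b) t - F a t - \<alpha> *\<^sub>R F b t) (at t)"
          unfolding u_def F_def
          by (intro has_vector_derivative_diff Rder \<rho> t
              bounded_linear.has_vector_derivative[OF bounded_linear_scaleR_right])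
        let ?D = "Df (\<Phi> t z0)"
        have in_B: "\<Phi> t z0 \<in> B" by (intro stay z0 t)
        define E where "E a = F a t - ?D (R a t)" for a
        have E: "norm (E x) \<le> e' * norm x" if "norm x < d" for x
          unfolding E_def F_def by (rule d[OF that t])
        have eq: "F (a + \<alpha> *\<^sub>R b) t - F a t - \<alpha> *\<^sub>R F b t = ?D (u t) + (E (a + \<alpha> *\<^sub>R b) - E a - \<alpha> *\<^sub>R E b)"
          using lin[OF in_B] by (simp add: E_def u_def linear_add linear_diff linear_scale algebra_simps)
        have "norm (E (a + \<alpha> *\<^sub>R b) - E a - \<alpha> *\<^sub>R E b)
            \<le> norm (E (a + \<alpha> *\<^sub>R b)) + norm (E a) + \<bar>\<alpha>\<bar> * norm (E b)"
          by (metis (no_types, opaque_lifting) add_mono norm_scaleR norm_triangle_ineq4 order_refl order_trans)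
        also have "\<dots> \<le> e' * norm (a + \<alpha> *\<^sub>R b) + e' * norm a + \<bar>\<alpha>\<bar> * (e' * norm b)"
          by (intro add_mono mult_left_mono E a b ab) auto
        also have "\<dots> \<le> e' * (norm a + \<bar>\<alpha>\<bar> * norm b) + e' * norm a + \<bar>\<alpha>\<bar> * (e' * norm b)"
          using \<open>e' > 0\<close> norm_triangle_ineq[of a "\<alpha> *\<^sub>R b"] by (intro add_mono mult_left_mono) auto
        also have "\<dots> = 2 * e' * S" by (simp add: S_def algebra_simps)
        finally show "norm (F (a + \<alpha> *\<^sub>R b) t - F a t - \<alpha> *\<^sub>R F b t) \<le> K * norm (u t) + 2 * e' * S"
          unfolding eq using bound[OF in_B, of "u t"] norm_triangle_ineq by (smt (verit, best))
      qed (use \<open>e' > 0\<close> in \<open>simp add: S_def\<close>)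
      also have "u 0 = 0" by (simp add: u_def R_init \<rho>)
      finally show ?thesis
        using \<open>C > 0\<close> by (simp add: u_def e'_def S_def flip: C_def)
    qed
    then show "\<exists>d>0. \<forall>a b \<alpha>. norm a < d \<longrightarrow> norm b < d \<longrightarrow> norm (a + \<alpha> *\<^sub>R b) < d \<longrightarrow>
        norm (R (a + \<alpha> *\<^sub>R b) s - R a s - \<alpha> *\<^sub>R R b s) \<le> e * (norm a + \<bar>\<alpha>\<bar> * norm b)"
      using d0 by blast
  qed
  then obtain L where L: "((\<lambda>a. R a s) has_derivative L) (at 0)" by blast
  have "((\<lambda>z. R (z - z0) s + \<Phi> s z0) has_derivative L) (at z0)"
  proof -
    have "((\<lambda>z. z - z0) has_derivative (\<lambda>h. h)) (at z0)"
      by (auto intro!: derivative_eq_intros)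
    from has_derivative_compose[OF this, of "\<lambda>a. R a s" L] L
    have "((\<lambda>z. R (z - z0) s) has_derivative L) (at z0)" by simp
    then show ?thesis by (rule has_derivative_add_const)
  qed
  then have "(\<Phi> s has_derivative L) (at z0)" by (simp add: R_def)
  moreover have "L (y 0) = y s"
    if y: "\<And>t. 0 \<le> t \<Longrightarrow> t \<le> s \<Longrightarrow> (y has_vector_derivative Df (\<Phi> t z0) (y t)) (at t)" for y
  proof -
    let ?v = "y 0"
    have "((\<lambda>h. h *\<^sub>R ?v) has_derivative (\<lambda>h. h *\<^sub>R ?v)) (at (0::real))"
      by (auto intro!: derivative_eq_intros)
    from has_derivative_compose[OF this, of "\<lambda>a. R a s" L] L
    have "((\<lambda>h. R (h *\<^sub>R ?v) s) has_vector_derivative L ?v) (at 0)"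
      by (simp add: has_vector_derivative_def linear_scale[OF has_derivative_linear[OF L]])
    moreover have "((\<lambda>h. R (h *\<^sub>R ?v) s) has_vector_derivative y s) (at 0)"
      unfolding has_vector_derivative_def has_derivative_at_alt
    proof (intro conjI allI impI)
      fix e :: real assume "e > 0"
      define e' where "e' = e / (C * (norm ?v + 1))"
      have "e' > 0" using \<open>e > 0\<close> \<open>C > 0\<close> by (simp add: e'_def add_nonneg_pos)
      obtain d where d0: "d > 0" "d \<le> \<rho>" and d: "\<And>a t. norm a < d \<Longrightarrow> 0 \<le> t \<Longrightarrow> t \<le> s \<Longrightarrow>
        norm (f (\<Phi> t (z0 + a)) - f (\<Phi> t z0) - Df (\<Phi> t z0) (R a t)) \<le> e' * norm a"
        using key[OF \<open>e' > 0\<close>] by blast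
      have "norm (R (h *\<^sub>R ?v) s - h *\<^sub>R y s) \<le> e * \<bar>h\<bar>" if h: "\<bar>h\<bar> < d / (norm ?v + 1)" for h
      proof -
        have "\<bar>h\<bar> * (norm ?v + 1) < d"
          using h by (simp add: pos_less_divide_eq add_nonneg_pos)
        then have hv: "norm (h *\<^sub>R ?v) < d" by (simp add: distrib_left)
        then have hv\<rho>: "norm (h *\<^sub>R ?v) < \<rho>" using d0 by linarith
        define u where "u t = R (h *\<^sub>R ?v) t - h *\<^sub>R y t" for t
        have "norm (u s) \<le> (norm (u 0) + e' * norm (h *\<^sub>R ?v)) * exp ((K + 1) * s)"
        proof (rule gronwall_affine[OF _ _ \<open>0 \<le> K\<close> _ \<open>0 \<le> s\<close> order_refl])
          fix t assume t: "0 \<le> t" "t \<le> s"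
          let ?D = "Df (\<Phi> t z0)"
          show "(u has_vector_derivative f (\<Phi> t (z0 + h *\<^sub>R ?v)) - f (\<Phi> t z0) - h *\<^sub>R ?D (y t)) (at t)"
            unfolding u_def
            by (intro has_vector_derivative_diff Rder hv\<rho> t y
              bounded_linear.has_vector_derivative[OF bounded_linear_scaleR_right])
          have in_B: "\<Phi> t z0 \<in> B" by (intro stay z0 t)
          have "f (\<Phi> t (z0 + h *\<^sub>R ?v)) - f (\<Phi> t z0) - h *\<^sub>R ?D (y t) =
            ?D (u t) + (f (\<Phi> t (z0 + h *\<^sub>R ?v)) - f (\<Phi> t z0) - ?D (R (h *\<^sub>R ?v) t))"
            using lin[OF in_B] by (simp add: u_def linear_diff linear_scale)
          then show "norm (f (\<Phi> t (z0 + h *\<^sub>R ?v)) - f (\<Phi> t z0) - h *\<^sub>R ?D (y t))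
              \<le> K * norm (u t) + e' * norm (h *\<^sub>R ?v)"
            using bound[OF in_B, of "u t"] d[OF hv t] norm_triangle_ineq by (smt (verit, best))
        qed (use \<open>e' > 0\<close> in simp)
        also have "u 0 = 0" by (simp add: u_def R_init[OF hv\<rho>])
        also have "(norm (0::'a) + e' * norm (h *\<^sub>R ?v)) * exp ((K + 1) * s) = e' * C * (\<bar>h\<bar> * norm ?v)"
          by (simp add: C_def)
        also have "\<dots> \<le> e' * C * (\<bar>h\<bar> * (norm ?v + 1))"
          using \<open>e' > 0\<close> \<open>C > 0\<close> by (intro mult_left_mono) auto
        also have "\<dots> = e * \<bar>h\<bar>"
        proof -
          have "norm ?v + 1 \<noteq> 0" using norm_ge_zero[of ?v] by linarith
          then show ?thesis using \<open>C > 0\<close> by (simp add: e'_def)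
        qed
        finally show ?thesis by (simp add: u_def)
      qed
      moreover have "d / (norm ?v + 1) > 0" using d0 by (simp add: add_nonneg_pos)
      moreover have "R 0 s = 0" by (simp add: R_def)
      ultimately show "\<exists>d>0. \<forall>h. norm (h - 0) < d \<longrightarrow>
          norm (R (h *\<^sub>R ?v) s - R (0 *\<^sub>R ?v) s - (h - 0) *\<^sub>R y s) \<le> e * norm (h - 0)"
        by (intro exI[of _ "d / (norm ?v + 1)"]) simp
    qed (rule bounded_linear_scaleR_left)
    ultimately show ?thesis by (rule vector_derivative_unique_at)
  qed
  ultimately show ?thesis by blast
qed

section \<open>Charts, tangent vectors and differentials\<close>

lemma eq_on_closure:
  fixes F G :: "'a::topological_space \<Rightarrow> 'b::real_normed_vector"
  assumes "continuous_on U F" "continuous_on U G" "open U" "x \<in> U" "x \<in> closure D"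
    and eq: "\<And>y. y \<in> D \<Longrightarrow> y \<in> U \<Longrightarrow> F y = G y"
  shows "F x = G x"
proof (rule ccontr)
  assume "F x \<noteq> G x"
  let ?W = "(\<lambda>y. F y - G y) -` (- {0}) \<inter> U"
  have "open ?W"
    using assms(1-3) by (intro continuous_on_open_vimage[THEN iffD1, rule_format] continuous_intros) auto
  moreover have "x \<in> ?W" using \<open>F x \<noteq> G x\<close> \<open>x \<in> U\<close> by simp
  ultimately have "?W \<inter> D \<noteq> {}"
    using open_Int_closure_eq_empty[of ?W D] \<open>x \<in> closure D\<close> by blast
  then show False using eq by auto
qed

locale smooth_manifold =
  fixes A :: "('m::t2_space, 'e::euclidean_space) chart set"
  assumes atlas: "smooth_atlas A"
begin

lemma charts_at_nonempty: "\<exists>c. c \<in> charts_at A p"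
  using atlas unfolding smooth_atlas_def charts_at_def by blast

lemma charts_atD: "c \<in> charts_at A p \<Longrightarrow> c \<in> A" "c \<in> charts_at A p \<Longrightarrow> p \<in> chart_dom c"
  by (auto simp: charts_at_def)

lemma chart_homeomorphism:
  assumes "c \<in> A"
  shows "open (chart_dom c)" "open (chart_ran c)"
    "homeomorphism (chart_dom c) (chart_ran c) (chart_map c) (chart_inv c)"
  using atlas assms unfolding smooth_atlas_def by blast+

lemma chart_simps:
  assumes "c \<in> A"
  shows "x \<in> chart_dom c \<Longrightarrow> chart_inv c (chart_map c x) = x"
    "z \<in> chart_ran c \<Longrightarrow> chart_map c (chart_inv c z) = z"
    "x \<in> chart_dom c \<Longrightarrow> chart_map c x \<in> chart_ran c"
    "z \<in> chart_ran c \<Longrightarrow> chart_inv c z \<in> chart_dom c"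
  using chart_homeomorphism(3)[OF assms] unfolding homeomorphism_def by auto

lemma chart_continuous:
  assumes "c \<in> A"
  shows "continuous_on (chart_dom c) (chart_map c)" "continuous_on (chart_ran c) (chart_inv c)"
  using chart_homeomorphism(3)[OF assms] unfolding homeomorphism_def by auto

lemma chart_isCont:
  assumes "c \<in> A"
  shows "x \<in> chart_dom c \<Longrightarrow> isCont (chart_map c) x" "z \<in> chart_ran c \<Longrightarrow> isCont (chart_inv c) z"
  using chart_continuous[OF assms] chart_homeomorphism[OF assms]
  by (simp_all add: continuous_on_eq_continuous_at)

lemma transition_has_derivative:
  assumes "c \<in> charts_at A p" "d \<in> charts_at A p"
  shows "((chart_map d \<circ> chart_inv c) has_derivative
      frechet_derivative (chart_map d \<circ> chart_inv c) (at (chart_map c p))) (at (chart_map c p))"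
proof -
  have "smooth_on (chart_map c ` (chart_dom c \<inter> chart_dom d)) (chart_map d \<circ> chart_inv c)"
    using atlas assms unfolding smooth_atlas_def charts_at_def by blast
  then have "Ck_on (Suc 0) (chart_map c ` (chart_dom c \<inter> chart_dom d)) (chart_map d \<circ> chart_inv c)"
    unfolding smooth_on_def by blast
  then have "(chart_map d \<circ> chart_inv c) differentiable (at (chart_map c p))"
    using assms by (auto simp: charts_at_def)
  then show ?thesis by (simp add: frechet_derivative_works)
qed

lemma tangent_space_transition:
  assumes "v \<in> tangent_space A p" "c \<in> charts_at A p" "d \<in> charts_at A p"
  shows "v d = frechet_derivative (chart_map d \<circ> chart_inv c) (at (chart_map c p)) (v c)"
  using assms unfolding tangent_space_def by blast

lemma tangent_space_outside: "v \<in> tangent_space A p \<Longrightarrow> c \<notin> charts_at A p \<Longrightarrow> v c = 0"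
  unfolding tangent_space_def by blast

text \<open>
  Coordinates in one chart determine a tangent vector, linearly, through the transition maps.
\<close>

lemma proportional_if_in_one_chart:
  assumes v: "v \<in> tangent_space A p" and w: "w \<in> tangent_space A p"
    and c: "c \<in> charts_at A p" and eq: "v c = k *\<^sub>R w c"
  shows "v = k *\<^sub>R w"
proof
  fix d
  show "v d = (k *\<^sub>R w) d"
  proof (cases "d \<in> charts_at A p")
    case True
    show ?thesis
      using has_derivative_linear[OF transition_has_derivative[OF c True]]
      by (simp add: tangent_space_transition[OF v c True] tangent_space_transition[OF w c True]
          eq linear_scale scaleR_fun_def)
  qed (simp add: tangent_space_outside[OF v] tangent_space_outside[OF w] scaleR_fun_def)
qed

text \<open>
  The map \<open>f\<close> is differentiable at \<open>p\<close> and its differential sends \<open>v\<close> to \<open>w\<close>. Continuity is part of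
  the notion because the chart expressions of \<open>f\<close> describe it only as long as nearby points are sent
  into the chart domain. Quantifying over all charts lets the users of the notion choose theirs.
\<close>

definition pushes_forward :: "('m \<Rightarrow> 'm) \<Rightarrow> 'm \<Rightarrow> ('m, 'e) tvec \<Rightarrow> ('m, 'e) tvec \<Rightarrow> bool"
  where "pushes_forward f p v w \<longleftrightarrow> isCont f p \<and>
    (\<forall>c\<in>charts_at A p. \<forall>d\<in>charts_at A (f p). \<exists>L.
       ((chart_map d \<circ> f \<circ> chart_inv c) has_derivative L) (at (chart_map c p)) \<and> L (v c) = w d)"

text \<open>
  The chain rule with the chart \<open>e\<close> inserted after \<open>f\<close>. Continuity of \<open>f\<close> keeps nearby points in
  the domain of \<open>e\<close>, where the chart and its inverse cancel.
\<close>

lemma has_derivative_through_chart: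
  assumes "isCont f p" and c: "c \<in> charts_at A p" and e: "e \<in> charts_at A (f p)"
    and L: "((chart_map e \<circ> f \<circ> chart_inv c) has_derivative L) (at (chart_map c p))"
    and M: "((h \<circ> chart_inv e) has_derivative M) (at (chart_map e (f p)))"
  shows "((h \<circ> f \<circ> chart_inv c) has_derivative (M \<circ> L)) (at (chart_map c p))"
proof -
  note c' = charts_atD[OF c] and e' = charts_atD[OF e]
  let ?z = "chart_map c p"
  have z: "chart_inv c ?z = p" by (simp add: chart_simps c')
  have "((h \<circ> chart_inv e \<circ> (chart_map e \<circ> f \<circ> chart_inv c)) has_derivative (M \<circ> L)) (at ?z)"
    by (rule diff_chain_at[OF L]) (use M in \<open>simp add: z\<close>)
  moreover have "\<forall>\<^sub>F z in at ?z. (h \<circ> chart_inv e \<circ> (chart_map e \<circ> f \<circ> chart_inv c)) z = (h \<circ> f \<circ> chart_inv c) z"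
  proof -
    have "isCont (\<lambda>z. f (chart_inv c z)) ?z"
      using assms(1) chart_isCont(2)[OF c'(1)] chart_simps(3)[OF c'] by (intro isCont_o2[where g = f and f = "chart_inv c"]) (simp_all add: z)
    then have "\<forall>\<^sub>F z in at ?z. f (chart_inv c z) \<in> chart_dom e"
      unfolding isCont_def using chart_homeomorphism(1)[OF e'(1)] e'(2)
      by (intro topological_tendstoD) (simp_all add: z)
    then show ?thesis by eventually_elim (simp add: chart_simps e'(1))
  qed
  ultimately show ?thesis
    by (rule has_derivative_transform_eventually) (use e' in \<open>simp_all add: z chart_simps\<close>)
qed

text \<open>
  Charts at the source and at the target are exchanged one after the other, by the chain rule with
  a transition map on either side.
\<close>

lemma pushes_forward_if_in_one_chart:
  assumes f: "isCont f p" and c: "c \<in> charts_at A p" and d: "d \<in> charts_at A (f p)"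
    and v: "v \<in> tangent_space A p" and w: "w \<in> tangent_space A (f p)"
    and L: "((chart_map d \<circ> f \<circ> chart_inv c) has_derivative L) (at (chart_map c p))"
    and eq: "L (v c) = w d"
  shows "pushes_forward f p v w"
  unfolding pushes_forward_def
proof (intro conjI ballI f)
  fix c' d' assume c': "c' \<in> charts_at A p" and d': "d' \<in> charts_at A (f p)"
  let ?N = "frechet_derivative (chart_map c \<circ> chart_inv c') (at (chart_map c' p))"
  let ?M = "frechet_derivative (chart_map d' \<circ> chart_inv d) (at (chart_map d (f p)))"
  have "((chart_map d' \<circ> f \<circ> chart_inv c) has_derivative ?M \<circ> L) (at (chart_map c p))"
    by (rule has_derivative_through_chart[OF f c d L transition_has_derivative[OF d d']])
  then have "((chart_map d' \<circ> f \<circ> id \<circ> chart_inv c') has_derivative ?M \<circ> L \<circ> ?N) (at (chart_map c' p))"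
    using transition_has_derivative[OF c' c] c c'
    by (intro has_derivative_through_chart[where f = id and e = c]) simp_all
  moreover have "(?M \<circ> L \<circ> ?N) (v c') = w d'"
    using tangent_space_transition[OF v c' c] tangent_space_transition[OF w d d'] eq by simp
  ultimately show "\<exists>L. ((chart_map d' \<circ> f \<circ> chart_inv c') has_derivative L) (at (chart_map c' p)) \<and> L (v c') = w d'"
    by auto
qed

lemma pushes_forward_comp:
  assumes f: "pushes_forward f p u v" and g: "pushes_forward g (f p) v w"
    and u: "u \<in> tangent_space A p" and w: "w \<in> tangent_space A (g (f p))"
  shows "pushes_forward (g \<circ> f) p u w"
proof -
  obtain c d e where c: "c \<in> charts_at A p" and e: "e \<in> charts_at A (f p)" and d: "d \<in> charts_at A (g (f p))"
    using charts_at_nonempty by metis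
  obtain L where L: "((chart_map e \<circ> f \<circ> chart_inv c) has_derivative L) (at (chart_map c p))" "L (u c) = v e"
    using f c e unfolding pushes_forward_def by blast
  obtain M where M: "((chart_map d \<circ> g \<circ> chart_inv e) has_derivative M) (at (chart_map e (f p)))" "M (v e) = w d"
    using g e d unfolding pushes_forward_def by blast
  show ?thesis
  proof (rule pushes_forward_if_in_one_chart[OF _ c _ u])
    show "isCont (g \<circ> f) p" using f g by (intro continuous_at_compose) (simp_all add: pushes_forward_def)
    show "((chart_map d \<circ> (g \<circ> f) \<circ> chart_inv c) has_derivative M \<circ> L) (at (chart_map c p))"
      using has_derivative_through_chart[OF _ c e L(1) M(1)] f by (simp add: pushes_forward_def comp_def)
    show "(M \<circ> L) (u c) = w d" by (simp add: L(2) M(2))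
  qed (use d w in simp_all)
qed

lemma tangent_map_eq:
  assumes f: "pushes_forward f p v w" and w: "w \<in> tangent_space A (f p)"
  shows "tangent_map A f p v = w"
proof
  fix d
  let ?c = "SOME c. c \<in> charts_at A p"
  have c: "?c \<in> charts_at A p" using charts_at_nonempty by (rule someI_ex)
  show "tangent_map A f p v d = w d"
  proof (cases "d \<in> charts_at A (f p)")
    case True
    then obtain L where "((chart_map d \<circ> f \<circ> chart_inv ?c) has_derivative L) (at (chart_map ?c p))" "L (v ?c) = w d"
      using f c unfolding pushes_forward_def by blast
    moreover from this have "frechet_derivative (chart_map d \<circ> f \<circ> chart_inv ?c) (at (chart_map ?c p)) = L"
      using frechet_derivative_at by metis
    ultimately show ?thesis using True by (simp add: tangent_map_def Let_def)
  qed (simp add: tangent_map_def tangent_space_outside[OF w])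
qed

lemma linear_tangent_map:
  assumes f: "pushes_forward f p v w"
  shows "linear (tangent_map A f p)"
proof -
  let ?c = "SOME c. c \<in> charts_at A p"
  have c: "?c \<in> charts_at A p" using charts_at_nonempty by (rule someI_ex)
  have lin: "linear (frechet_derivative (chart_map d \<circ> f \<circ> chart_inv ?c) (at (chart_map ?c p)))"
    if "d \<in> charts_at A (f p)" for d
  proof -
    have "(chart_map d \<circ> f \<circ> chart_inv ?c) differentiable (at (chart_map ?c p))"
      using f c that unfolding pushes_forward_def differentiable_def by blast
    then show ?thesis by (simp add: frechet_derivative_works has_derivative_linear)
  qed
  show ?thesis
  proof (rule linearI; rule ext)
    fix u w d
    show "tangent_map A f p (u + w) d = (tangent_map A f p u + tangent_map A f p w) d"
      using lin[of d] by (simp add: tangent_map_def Let_def linear_add)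
  next
    fix a w d
    show "tangent_map A f p (a *\<^sub>R w) d = (a *\<^sub>R tangent_map A f p w) d"
      using lin[of d] by (simp add: tangent_map_def Let_def scaleR_fun_def linear_scale)
  qed
qed

section \<open>Vector fields and their integral curves\<close>

lemma vector_fieldD:
  assumes "X \<in> vector_fields A 1"
  shows "X p \<in> tangent_space A p" "c \<in> A \<Longrightarrow> Ck_on 1 (chart_ran c) (local_rep X c)"
  using assms unfolding vector_fields_def by blast+

lemma local_rep_chart_map: "c \<in> charts_at A p \<Longrightarrow> local_rep X c (chart_map c p) = X p c"
  by (simp add: local_rep_def charts_at_def chart_simps)

lemma vector_field_continuous_on:
  assumes "X \<in> vector_fields A 1" "c \<in> A"
  shows "continuous_on (chart_dom c) (\<lambda>p. X p c)"
proof -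
  have "continuous_on (chart_ran c) (local_rep X c)"
    using Ck_on_continuous vector_fieldD(2)[OF assms] .
  then have "continuous_on (chart_dom c) (\<lambda>p. local_rep X c (chart_map c p))"
    by (rule continuous_on_compose2[OF _ chart_continuous(1)[OF assms(2)]])
      (auto simp: chart_ran_def)
  then show ?thesis
    by (rule continuous_on_eq) (simp add: local_rep_chart_map charts_at_def assms)
qed

text \<open>
  Proportionality of \<open>Y\<close> and \<open>X\<close> is asked for along \<open>\<gamma>\<close> alone; this makes the lemma applicable on
  an invariant set on which the two fields happen to be proportional.
\<close>

lemma integral_curve_affine:
  assumes "integral_curve A X \<gamma>" "\<And>t. Y (\<gamma> (k * t + b)) = k *\<^sub>R X (\<gamma> (k * t + b))"
  shows "integral_curve A Y (\<lambda>t. \<gamma> (k * t + b))"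
  unfolding integral_curve_def
proof (intro allI conjI ballI)
  fix t
  show "isCont (\<lambda>t. \<gamma> (k * t + b)) t"
    using assms(1) unfolding integral_curve_def
    by (intro isCont_o2[where g = \<gamma> and f = "\<lambda>t. k * t + b"] continuous_intros) auto
  fix c assume "c \<in> charts_at A (\<gamma> (k * t + b))"
  then have "((chart_map c \<circ> \<gamma>) has_vector_derivative X (\<gamma> (k * t + b)) c) (at (k * t + b))"
    using assms(1) unfolding integral_curve_def by blast
  moreover have "((\<lambda>t. k * t + b) has_vector_derivative k) (at t)"
    by (auto intro!: derivative_eq_intros simp flip: has_real_derivative_iff_has_vector_derivative)
  ultimately have "((chart_map c \<circ> \<gamma>) \<circ> (\<lambda>t. k * t + b) has_vector_derivative k *\<^sub>R X (\<gamma> (k * t + b)) c) (at t)"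
    by (intro vector_diff_chain_at)
  then show "(chart_map c \<circ> (\<lambda>t. \<gamma> (k * t + b)) has_vector_derivative Y (\<gamma> (k * t + b)) c) (at t)"
    by (simp add: assms(2) scaleR_fun_def comp_def)
qed

lemma integral_curve_in_chart:
  assumes "integral_curve A X \<gamma>" "c \<in> charts_at A (\<gamma> t)"
  shows "((\<lambda>t. chart_map c (\<gamma> t)) has_vector_derivative local_rep X c (chart_map c (\<gamma> t))) (at t)"
  using assms by (simp add: integral_curve_def local_rep_chart_map comp_def)

lemma integral_curve_continuous: "integral_curve A X \<gamma> \<Longrightarrow> continuous_on UNIV \<gamma>"
  by (simp add: integral_curve_def continuous_at_imp_continuous_on)

lemma open_chart_preimage:
  assumes "c \<in> A" "open S"
  shows "open {x \<in> chart_dom c. chart_map c x \<in> S}"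
proof -
  have "{x \<in> chart_dom c. chart_map c x \<in> S} = chart_dom c \<inter> chart_map c -` S" by auto
  then show ?thesis
    using continuous_on_open_vimage[OF chart_homeomorphism(1)[OF assms(1)], of "chart_map c"]
      chart_continuous(1)[OF assms(1)] assms(2) by (simp add: Int_commute)
qed

text \<open>
  In a chart the field is Lipschitz, so the difference of two solutions that starts at \<open>0\<close> stays \<open>0\<close>
  by Gronwall.
\<close>

lemma integral_curves_agree_near:
  assumes X: "X \<in> vector_fields A 1" and 1: "integral_curve A X \<gamma>1" and 2: "integral_curve A X \<gamma>2"
    and eq: "\<gamma>1 0 = \<gamma>2 0"
  shows "\<exists>\<epsilon>>0. \<forall>t. \<bar>t\<bar> < \<epsilon> \<longrightarrow> \<gamma>1 t = \<gamma>2 t"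
proof -
  obtain c where c: "c \<in> charts_at A (\<gamma>1 0)" using charts_at_nonempty by blast
  note c' = charts_atD[OF c]
  let ?f = "local_rep X c" and ?z0 = "chart_map c (\<gamma>1 0)"
  obtain R where R: "R > 0" "cball ?z0 R \<subseteq> chart_ran c"
    using open_contains_cball chart_homeomorphism(2)[OF c'(1)] chart_simps(3)[OF c'] by blast
  obtain K where "K \<ge> 0"
    and lip: "\<And>x y. x \<in> cball ?z0 R \<Longrightarrow> y \<in> cball ?z0 R \<Longrightarrow> norm (?f x - ?f y) \<le> K * norm (x - y)"
    using C1_uniform_bounds[OF vector_fieldD(2)[OF X c'(1)] R(2) compact_cball convex_cball] by metis
  define V where "V = {x \<in> chart_dom c. chart_map c x \<in> ball ?z0 R}"
  have "open V" unfolding V_def by (intro open_chart_preimage c') simp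
  have "\<exists>\<epsilon>>0. \<forall>t. \<bar>t\<bar> < \<epsilon> \<longrightarrow> \<gamma> t \<in> V" if "integral_curve A X \<gamma>" "\<gamma> 0 = \<gamma>1 0" for \<gamma>
  proof -
    have "open (\<gamma> -` V)" using integral_curve_continuous[OF that(1)] \<open>open V\<close>
      by (simp add: continuous_on_open_vimage)
    moreover have "0 \<in> \<gamma> -` V" using that(2) R c' by (simp add: V_def)
    ultimately obtain \<epsilon> where "\<epsilon> > 0" "ball 0 \<epsilon> \<subseteq> \<gamma> -` V" using open_contains_ball by blast
    then show ?thesis by (intro exI[of _ \<epsilon>]) (auto simp: subset_eq)
  qed
  from this[OF 1 refl] this[OF 2 eq[symmetric]] obtain \<epsilon>1 \<epsilon>2 where \<epsilon>: "\<epsilon>1 > 0" "\<epsilon>2 > 0"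
    "\<And>t. \<bar>t\<bar> < \<epsilon>1 \<Longrightarrow> \<gamma>1 t \<in> V" "\<And>t. \<bar>t\<bar> < \<epsilon>2 \<Longrightarrow> \<gamma>2 t \<in> V" by blast
  define u where "u t = chart_map c (\<gamma>1 t) - chart_map c (\<gamma>2 t)" for t
  have "\<gamma>1 s = \<gamma>2 s" if s: "\<bar>s\<bar> < min \<epsilon>1 \<epsilon>2" for s
  proof -
    \<comment> \<open>The sign \<open>\<sigma>\<close> runs time backwards when \<open>s\<close> is negative.\<close>
    define \<sigma> :: real where "\<sigma> = (if s \<ge> 0 then 1 else - 1)"
    have "\<bar>\<sigma>\<bar> = 1" by (simp add: \<sigma>_def)
    have "norm (u (\<sigma> * \<bar>s\<bar>)) \<le> (norm (u (\<sigma> * 0)) + 0) * exp ((K + 1) * \<bar>s\<bar>)"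
    proof (rule gronwall_affine[where u = "\<lambda>t. u (\<sigma> * t)", OF _ _ \<open>K \<ge> 0\<close> order_refl abs_ge_zero order_refl])
      fix t assume t: "0 \<le> t" "t \<le> \<bar>s\<bar>"
      then have abs: "\<bar>\<sigma> * t\<bar> < min \<epsilon>1 \<epsilon>2" using s by (simp add: \<sigma>_def)
      then have V: "\<gamma>1 (\<sigma> * t) \<in> V" "\<gamma>2 (\<sigma> * t) \<in> V" using \<epsilon> by auto
      have "(u has_vector_derivative ?f (chart_map c (\<gamma>1 (\<sigma> * t))) - ?f (chart_map c (\<gamma>2 (\<sigma> * t)))) (at (\<sigma> * t))"
        unfolding u_def using V
        by (intro has_vector_derivative_diff integral_curve_in_chart[OF 1] integral_curve_in_chart[OF 2])
          (simp_all add: V_def charts_at_def c')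
      moreover have "((\<lambda>t. \<sigma> * t) has_vector_derivative \<sigma>) (at t)"
        by (auto intro!: derivative_eq_intros simp flip: has_real_derivative_iff_has_vector_derivative)
      ultimately have "(u \<circ> (\<lambda>t. \<sigma> * t) has_vector_derivative
          \<sigma> *\<^sub>R (?f (chart_map c (\<gamma>1 (\<sigma> * t))) - ?f (chart_map c (\<gamma>2 (\<sigma> * t))))) (at t)"
        by (intro vector_diff_chain_at)
      then show "((\<lambda>t. u (\<sigma> * t)) has_vector_derivative
          \<sigma> *\<^sub>R (?f (chart_map c (\<gamma>1 (\<sigma> * t))) - ?f (chart_map c (\<gamma>2 (\<sigma> * t))))) (at t)"
        by (simp add: comp_def)
      have "norm (?f (chart_map c (\<gamma>1 (\<sigma> * t))) - ?f (chart_map c (\<gamma>2 (\<sigma> * t)))) \<le> K * norm (u (\<sigma> * t))"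
        unfolding u_def by (intro lip) (use V in \<open>auto simp: V_def\<close>)
      then show "norm (\<sigma> *\<^sub>R (?f (chart_map c (\<gamma>1 (\<sigma> * t))) - ?f (chart_map c (\<gamma>2 (\<sigma> * t)))))
          \<le> K * norm (u (\<sigma> * t)) + 0"
        using \<open>\<bar>\<sigma>\<bar> = 1\<close> by simp
    qed
    also have "\<sigma> * \<bar>s\<bar> = s" by (simp add: \<sigma>_def)
    finally have "chart_map c (\<gamma>1 s) = chart_map c (\<gamma>2 s)" by (simp add: u_def eq)
    moreover have "\<gamma>1 s \<in> V" "\<gamma>2 s \<in> V" using s \<epsilon> by auto
    ultimately show ?thesis
      using chart_simps(1)[OF c'(1)] unfolding V_def by (metis (no_types, lifting) mem_Collect_eq)
  qed
  then show ?thesis using \<epsilon> by (intro exI[of _ "min \<epsilon>1 \<epsilon>2"]) simp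
qed

lemma integral_curve_shift: "integral_curve A X \<gamma> \<Longrightarrow> integral_curve A X (\<lambda>t. \<gamma> (t + b))"
  using integral_curve_affine[of X \<gamma> X 1 b] by (simp add: scaleR_fun_def)

text \<open>
  The set of times at which two integral curves agree is closed since the manifold is a Hausdorff
  space, and open by local uniqueness.
\<close>

lemma integral_curve_unique:
  assumes X: "X \<in> vector_fields A 1" and 1: "integral_curve A X \<gamma>1" and 2: "integral_curve A X \<gamma>2"
    and eq: "\<gamma>1 0 = \<gamma>2 0"
  shows "\<gamma>1 t = \<gamma>2 t"
proof -
  define T where "T = {t. \<gamma>1 t = \<gamma>2 t}"
  have "closed T" unfolding T_def
    by (intro closed_Collect_eq integral_curve_continuous[OF 1] integral_curve_continuous[OF 2])
  moreover have "open T"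
    unfolding open_contains_ball
  proof
    fix b assume "b \<in> T"
    then have "\<gamma>1 (0 + b) = \<gamma>2 (0 + b)" by (simp add: T_def)
    from integral_curves_agree_near[OF X integral_curve_shift[OF 1] integral_curve_shift[OF 2] this]
    obtain \<epsilon> where \<epsilon>: "\<epsilon> > 0" "\<And>t. \<bar>t\<bar> < \<epsilon> \<Longrightarrow> \<gamma>1 (t + b) = \<gamma>2 (t + b)" by blast
    have "ball b \<epsilon> \<subseteq> T"
      using \<epsilon>(2)[of "t - b" for t] by (auto simp: T_def dist_real_def abs_minus_commute)
    then show "\<exists>\<epsilon>>0. ball b \<epsilon> \<subseteq> T" using \<epsilon>(1) by blast
  qed
  ultimately have "T = {} \<or> T = UNIV" using clopen by blast
  moreover have "0 \<in> T" by (simp add: T_def eq)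
  ultimately show ?thesis by (auto simp: T_def)
qed

lemma flow_zero: "flow_generated_by A X \<phi> \<Longrightarrow> \<phi> 0 x = x"
  and flow_integral_curve: "flow_generated_by A X \<phi> \<Longrightarrow> integral_curve A X (\<lambda>t. \<phi> t x)"
  by (simp_all add: flow_generated_by_def)

lemma flow_add:
  assumes X: "X \<in> vector_fields A 1" and \<phi>: "flow_generated_by A X \<phi>"
  shows "\<phi> (s + t) x = \<phi> s (\<phi> t x)"
  by (rule integral_curve_unique[OF X integral_curve_shift[OF flow_integral_curve[OF \<phi>]] flow_integral_curve[OF \<phi>]])
    (simp add: flow_zero[OF \<phi>])

text \<open>
  A curve of speed at most \<open>M\<close> cannot leave a ball before it has covered the distance to the
  boundary. On a manifold one must also exclude that it leaves the chart domain without being seen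
  in coordinates: up to the first exit time it stays in the preimage of the closed ball, which is
  compact and hence closed.
\<close>

lemma integral_curve_stays_in_chart:
  assumes c: "c \<in> A" and R: "cball z0 R \<subseteq> chart_ran c"
    and M: "\<And>z. z \<in> cball z0 R \<Longrightarrow> norm (local_rep X c z) \<le> M"
    and \<gamma>: "integral_curve A X \<gamma>" and init: "\<gamma> 0 \<in> chart_dom c" "chart_map c (\<gamma> 0) \<in> ball z0 r"
    and "0 \<le> M" "M * \<epsilon> \<le> R - r" "0 \<le> t" "t \<le> \<epsilon>"
  shows "\<gamma> t \<in> chart_dom c \<and> chart_map c (\<gamma> t) \<in> ball z0 R"
proof (rule ccontr)
  define V where "V = {x \<in> chart_dom c. chart_map c x \<in> ball z0 R}"
  define N where "N = chart_inv c ` cball z0 R"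
  have "open V" unfolding V_def by (intro open_chart_preimage c) simp
  have "compact N" unfolding N_def
    by (intro compact_continuous_image continuous_on_subset[OF chart_continuous(2)[OF c] R] compact_cball)
  have N: "x \<in> chart_dom c \<and> chart_map c x \<in> cball z0 R" if "x \<in> N" for x
    using that R chart_simps[OF c] by (auto simp: N_def)
  have "V \<subseteq> N"
  proof
    fix x assume "x \<in> V"
    then have "x = chart_inv c (chart_map c x)" "chart_map c x \<in> cball z0 R"
      using chart_simps[OF c] by (auto simp: V_def)
    then show "x \<in> N" unfolding N_def by (rule image_eqI)
  qed
  note cont = integral_curve_continuous[OF \<gamma>]
  define T where "T = {0..} \<inter> \<gamma> -` (- V)"
  assume "\<not> ?thesis"
  then have "t \<in> T" using \<open>0 \<le> t\<close> by (auto simp: T_def V_def)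
  have "closed T"
    unfolding T_def using cont \<open>open V\<close> by (intro closed_Int) (auto simp: continuous_on_closed_vimage closed_Compl)
  moreover have bdd: "bdd_below T" by (auto simp: T_def intro: bdd_belowI[of _ 0])
  ultimately have t1: "Inf T \<in> T" using \<open>t \<in> T\<close> by (intro closed_contains_Inf) auto
  define t1 where "t1 = Inf T"
  have before: "\<gamma> s \<in> V" if "0 \<le> s" "s < t1" for s
    using that cInf_lower[OF _ bdd, of s] by (force simp: T_def t1_def)
  have "t1 \<le> \<epsilon>" using cInf_lower[OF \<open>t \<in> T\<close> bdd] \<open>t \<le> \<epsilon>\<close> by (simp add: t1_def)
  have "0 \<le> t1" "\<gamma> t1 \<notin> V" using t1 by (auto simp: T_def t1_def)
  have "0 \<le> M * \<epsilon>" using \<open>0 \<le> M\<close> \<open>0 \<le> t\<close> \<open>t \<le> \<epsilon>\<close> by simp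
  then have "\<gamma> 0 \<in> V" using init \<open>M * \<epsilon> \<le> R - r\<close> by (auto simp: V_def)
  then have "t1 \<noteq> 0" using \<open>\<gamma> t1 \<notin> V\<close> by auto
  then have "0 < t1" using \<open>0 \<le> t1\<close> by simp
  have inN: "\<gamma> s \<in> N" if s: "s \<in> {0..t1}" for s
  proof -
    \<comment> \<open>Before \<open>t1\<close> the curve is in \<open>V\<close>; closedness of \<open>N\<close> adds the exit time itself.\<close>
    have "closed (\<gamma> -` N)" using cont compact_imp_closed[OF \<open>compact N\<close>]
      by (simp add: continuous_on_closed_vimage)
    moreover have "{0..<t1} \<subseteq> \<gamma> -` N" using before \<open>V \<subseteq> N\<close> by (auto simp: subset_iff)
    ultimately have "closure {0..<t1} \<subseteq> \<gamma> -` N" by (rule closure_minimal[rotated])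
    then show ?thesis using s \<open>0 < t1\<close> by auto
  qed
  have "norm (chart_map c (\<gamma> t1) - chart_map c (\<gamma> 0)) \<le> M * norm (t1 - 0)"
  proof (rule differentiable_bound[of "{0..t1}"])
    fix s assume s: "s \<in> {0..t1}"
    note N' = N[OF inN[OF s]]
    then have cs: "c \<in> charts_at A (\<gamma> s)" using c by (simp add: charts_at_def)
    then have "((\<lambda>t. chart_map c (\<gamma> t)) has_vector_derivative X (\<gamma> s) c) (at s)"
      using integral_curve_in_chart[OF \<gamma> cs] by (simp add: local_rep_chart_map)
    then show "((\<lambda>t. chart_map c (\<gamma> t)) has_derivative (\<lambda>h. h *\<^sub>R X (\<gamma> s) c)) (at s within {0..t1})"
      by (simp add: has_vector_derivative_def has_derivative_at_withinI)
    have "norm (X (\<gamma> s) c) \<le> M"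
      using M[of "chart_map c (\<gamma> s)"] N' local_rep_chart_map[OF cs, of X] by simp
    then show "onorm (\<lambda>h. h *\<^sub>R X (\<gamma> s) c) \<le> M"
      by (intro onorm_bound \<open>0 \<le> M\<close>) (simp add: mult.commute[of M] mult_left_mono)
  qed (use \<open>0 \<le> t1\<close> in auto)
  also have "\<dots> \<le> M * \<epsilon>" using \<open>0 \<le> t1\<close> \<open>t1 \<le> \<epsilon>\<close> \<open>0 \<le> M\<close> by (simp add: mult_left_mono)
  finally have "dist z0 (chart_map c (\<gamma> t1)) < R"
    using init(2) \<open>M * \<epsilon> \<le> R - r\<close> dist_triangle[of z0 "chart_map c (\<gamma> t1)" "chart_map c (\<gamma> 0)"]
    by (simp add: dist_norm norm_minus_commute)
  then have "\<gamma> t1 \<in> V" using N[OF inN[of t1]] \<open>0 \<le> t1\<close> by (simp add: V_def)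
  then show False using \<open>\<gamma> t1 \<notin> V\<close> by contradiction
qed

section \<open>Commuting fields are invariant under the flow\<close>

text \<open>
  A commuting field solves the linearised equation along each orbit: its derivative in the direction
  of \<open>X\<close> is \<open>DY X\<close>, which the vanishing bracket turns into \<open>DX Y\<close>.
\<close>

lemma commuting_field_along_flow:
  assumes X: "X \<in> vector_fields A 1" and Y: "Y \<in> vector_fields A 1"
    and \<gamma>: "integral_curve A X \<gamma>" and c: "c \<in> charts_at A (\<gamma> t)"
    and comm: "lie_bracket A X Y (\<gamma> t) = 0"
  shows "((\<lambda>t. local_rep Y c (chart_map c (\<gamma> t))) has_vector_derivative
      frechet_derivative (local_rep X c) (at (chart_map c (\<gamma> t))) (local_rep Y c (chart_map c (\<gamma> t)))) (at t)"
proof -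
  let ?z = "chart_map c (\<gamma> t)"
  have "local_rep Y c differentiable (at ?z)"
    using vector_fieldD(2)[OF Y charts_atD(1)[OF c]] chart_simps(3)[OF charts_atD[OF c]] by simp
  then have "(local_rep Y c has_derivative frechet_derivative (local_rep Y c) (at ?z)) (at ?z)"
    by (simp add: frechet_derivative_works)
  from vector_derivative_diff_chain_within[OF integral_curve_in_chart[OF \<gamma> c] has_derivative_at_withinI[OF this]]
  have "((\<lambda>t. local_rep Y c (chart_map c (\<gamma> t))) has_vector_derivative
      frechet_derivative (local_rep Y c) (at ?z) (local_rep X c ?z)) (at t)"
    by (simp add: comp_def)
  moreover have "lie_bracket A X Y (\<gamma> t) c = 0" using comm by simp
  ultimately show ?thesis
    using c by (simp add: lie_bracket_def local_rep_chart_map)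
qed

text \<open>
  Orbits that start near \<open>q\<close> stay in one chart for a short time that is the same for all of them,
  so that the Euclidean result applies there with \<open>Y\<close> as the solution of the linearised equation.
\<close>

lemma flow_pushes_forward_locally:
  assumes X: "X \<in> vector_fields A 1" and Y: "Y \<in> vector_fields A 1"
    and \<phi>: "flow_generated_by A X \<phi>" and comm: "\<And>p. lie_bracket A X Y p = 0"
  shows "\<exists>V \<epsilon>. open V \<and> q \<in> V \<and> \<epsilon> > 0 \<and>
    (\<forall>p\<in>V. \<forall>s. 0 \<le> s \<longrightarrow> s \<le> \<epsilon> \<longrightarrow> pushes_forward (\<phi> s) p (Y p) (Y (\<phi> s p)))"
proof -
  obtain c where c: "c \<in> charts_at A q" using charts_at_nonempty by blast
  note c' = charts_atD[OF c]
  let ?f = "local_rep X c" and ?z0 = "chart_map c q"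
  obtain R where R: "R > 0" "cball ?z0 R \<subseteq> chart_ran c"
    using open_contains_cball chart_homeomorphism(2)[OF c'(1)] chart_simps(3)[OF c'] by blast
  note C1 = vector_fieldD(2)[OF X c'(1)]
  obtain K where "K \<ge> 0"
    and bound: "\<And>x v. x \<in> cball ?z0 R \<Longrightarrow> norm (frechet_derivative ?f (at x) v) \<le> K * norm v"
    and lip: "\<And>x y. x \<in> cball ?z0 R \<Longrightarrow> y \<in> cball ?z0 R \<Longrightarrow> norm (?f x - ?f y) \<le> K * norm (x - y)"
    and unif: "\<And>e. e > 0 \<Longrightarrow> \<exists>d>0. \<forall>x\<in>cball ?z0 R. \<forall>y\<in>cball ?z0 R. norm (y - x) < d \<longrightarrow>
        norm (?f y - ?f x - frechet_derivative ?f (at x) (y - x)) \<le> e * norm (y - x)"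
    using C1_uniform_bounds[OF C1 R(2) compact_cball convex_cball] by blast
  have lin: "linear (frechet_derivative ?f (at x))" if "x \<in> cball ?z0 R" for x
  proof -
    have "?f differentiable (at x)" using C1 R(2) that by auto
    then show ?thesis by (simp add: frechet_derivative_works has_derivative_linear)
  qed
  have "compact (?f ` cball ?z0 R)"
    by (intro compact_continuous_image continuous_on_subset[OF Ck_on_continuous[OF C1] R(2)] compact_cball)
  then obtain M where M: "M > 0" "\<And>z. z \<in> cball ?z0 R \<Longrightarrow> norm (?f z) \<le> M"
    using compact_imp_bounded bounded_pos by (metis imageI)
  \<comment> \<open>Starting in the ball of radius \<open>R / 2\<close> with speed at most \<open>M\<close>, an orbit covers at most \<open>R / 2\<close>.\<close>
  define \<epsilon> where "\<epsilon> = R / (2 * M)"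
  have "\<epsilon> > 0" and M\<epsilon>: "M * \<epsilon> \<le> R - R / 2" using R(1) M(1) by (simp_all add: \<epsilon>_def)
  define V where "V = {x \<in> chart_dom c. chart_map c x \<in> ball ?z0 (R / 2)}"
  have "open V" unfolding V_def by (intro open_chart_preimage c') simp
  have "q \<in> V" using c' R(1) by (simp add: V_def)
  have stay: "\<phi> t p \<in> chart_dom c \<and> chart_map c (\<phi> t p) \<in> ball ?z0 R"
    if "p \<in> V" "0 \<le> t" "t \<le> \<epsilon>" for p t
  proof (rule integral_curve_stays_in_chart[where \<gamma> = "\<lambda>t. \<phi> t p",
        OF c'(1) R(2) M(2) flow_integral_curve[OF \<phi>] _ _ _ M\<epsilon> that(2,3)])
    show "0 \<le> M" using M(1) by simp
    show "\<phi> 0 p \<in> chart_dom c" "chart_map c (\<phi> 0 p) \<in> ball ?z0 (R / 2)"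
      using that(1) by (simp_all add: flow_zero[OF \<phi>] V_def)
  qed
  have "pushes_forward (\<phi> s) p (Y p) (Y (\<phi> s p))" if p: "p \<in> V" and s: "0 \<le> s" "s \<le> \<epsilon>" for p s
  proof -
    let ?w = "chart_map c p"
    have charts: "c \<in> charts_at A (\<phi> t p)" if "0 \<le> t" "t \<le> \<epsilon>" for t
      using stay[OF p that] c' by (simp add: charts_at_def)
    have cp: "c \<in> charts_at A p" using p c' by (simp add: V_def charts_at_def)
    have "?w \<in> ball ?z0 (R / 2)" using p by (simp add: V_def)
    then obtain \<rho> where \<rho>: "\<rho> > 0" "ball ?w \<rho> \<subseteq> ball ?z0 (R / 2)"
      using open_contains_ball open_ball by blast
    have half: "ball ?z0 (R / 2) \<subseteq> chart_ran c" using R by auto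
    have inV: "chart_inv c z \<in> V" if "z \<in> ball ?w \<rho>" for z
      using that \<rho>(2) half chart_simps[OF c'(1)] by (auto simp: V_def subset_iff)
    define \<Phi> where "\<Phi> t z = chart_map c (\<phi> t (chart_inv c z))" for t z
    have "\<exists>L. (\<Phi> s has_derivative L) (at ?w) \<and>
      (\<forall>y. (\<forall>t. 0 \<le> t \<longrightarrow> t \<le> s \<longrightarrow>
          (y has_vector_derivative frechet_derivative ?f (at (\<Phi> t ?w)) (y t)) (at t)) \<longrightarrow> L (y 0) = y s)"
    proof (rule flow_differentiable_euclidean[OF \<open>K \<ge> 0\<close> s(1) \<rho>(1) lin bound lip unif])
      fix z t assume z: "z \<in> ball ?w \<rho>" and t: "0 \<le> t" "t \<le> s"
      have st: "\<phi> t (chart_inv c z) \<in> chart_dom c \<and> \<Phi> t z \<in> ball ?z0 R"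
        unfolding \<Phi>_def using stay[OF inV[OF z]] t s by auto
      then show "\<Phi> t z \<in> cball ?z0 R" by auto
      show "((\<lambda>t. \<Phi> t z) has_vector_derivative ?f (\<Phi> t z)) (at t)"
        unfolding \<Phi>_def using st c'(1)
        by (intro integral_curve_in_chart flow_integral_curve[OF \<phi>]) (simp add: charts_at_def)
    next
      fix z assume z: "z \<in> ball ?w \<rho>"
      then have "z \<in> chart_ran c" using \<rho>(2) half by blast
      then show "\<Phi> 0 z = z" by (simp add: \<Phi>_def flow_zero[OF \<phi>] chart_simps c')
    qed
    then obtain L where L: "(\<Phi> s has_derivative L) (at ?w)"
      and sol: "\<And>y. (\<And>t. 0 \<le> t \<Longrightarrow> t \<le> s \<Longrightarrow>
          (y has_vector_derivative frechet_derivative ?f (at (\<Phi> t ?w)) (y t)) (at t)) \<Longrightarrow> L (y 0) = y s"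
      by blast
    have inv: "chart_inv c ?w = p" using p by (simp add: V_def chart_simps c')
    have cont: "isCont (\<phi> s) p"
    proof -
      have "isCont (\<Phi> s) ?w" using has_derivative_continuous[OF L] .
      moreover have "isCont (chart_map c) p" using chart_isCont(1)[OF charts_atD[OF cp]] .
      ultimately have "isCont (\<lambda>x. \<Phi> s (chart_map c x)) p" by (intro isCont_o2[where g = "\<Phi> s" and f = "chart_map c"])
      moreover have "isCont (chart_inv c) (\<Phi> s ?w)"
        using chart_isCont(2)[OF c'(1)] chart_simps(3)[OF c'(1)] stay[OF p s] by (simp add: \<Phi>_def inv)
      ultimately have "isCont (\<lambda>x. chart_inv c (\<Phi> s (chart_map c x))) p"
        by (intro isCont_o2[where g = "chart_inv c" and f = "\<lambda>x. \<Phi> s (chart_map c x)"])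
      moreover have "\<forall>\<^sub>F x in nhds p. chart_inv c (\<Phi> s (chart_map c x)) = \<phi> s x"
        using eventually_nhds_in_open[OF \<open>open V\<close> p]
      proof eventually_elim
        case (elim x)
        then have "chart_inv c (chart_map c x) = x" by (simp add: V_def chart_simps c')
        then show ?case using stay[OF elim s] by (simp add: \<Phi>_def chart_simps c')
      qed
      ultimately show ?thesis by (simp add: isCont_cong)
    qed
    define y where "y t = local_rep Y c (chart_map c (\<phi> t p))" for t
    have "L (y 0) = y s"
    proof (rule sol)
      fix t assume t: "0 \<le> t" "t \<le> s"
      then have "c \<in> charts_at A (\<phi> t p)" using charts s by simp
      from commuting_field_along_flow[OF X Y flow_integral_curve[OF \<phi>] this comm]
      show "(y has_vector_derivative frechet_derivative ?f (at (\<Phi> t ?w)) (y t)) (at t)"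
        by (simp add: y_def[abs_def] \<Phi>_def inv)
    qed
    then have "L (Y p c) = Y (\<phi> s p) c"
      by (simp add: y_def flow_zero[OF \<phi>] local_rep_chart_map[OF cp] local_rep_chart_map[OF charts[OF s]])
    moreover have "((chart_map c \<circ> \<phi> s \<circ> chart_inv c) has_derivative L) (at ?w)"
      using L by (simp add: \<Phi>_def[abs_def] comp_def)
    ultimately show ?thesis
      by (intro pushes_forward_if_in_one_chart[OF cont cp charts[OF s]] vector_fieldD(1)[OF Y])
  qed
  then show ?thesis using \<open>open V\<close> \<open>q \<in> V\<close> \<open>\<epsilon> > 0\<close> by blast
qed

text \<open>
  Compactness makes the short time of the local result uniform; a longer time is divided into short
  steps, which are composed by the chain rule.
\<close>

lemma flow_pushes_forward:
  assumes "compact (UNIV :: 'm set)"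
    and X: "X \<in> vector_fields A 1" and Y: "Y \<in> vector_fields A 1"
    and \<phi>: "flow_generated_by A X \<phi>" and comm: "\<And>p. lie_bracket A X Y p = 0"
    and "0 \<le> t"
  shows "pushes_forward (\<phi> t) p (Y p) (Y (\<phi> t p))"
proof -
  obtain V \<epsilon> where V: "\<And>q. open (V q)" "\<And>q. q \<in> V q" "\<And>q. \<epsilon> q > (0::real)"
    and loc: "\<And>q p s. p \<in> V q \<Longrightarrow> 0 \<le> s \<Longrightarrow> s \<le> \<epsilon> q \<Longrightarrow> pushes_forward (\<phi> s) p (Y p) (Y (\<phi> s p))"
    using flow_pushes_forward_locally[OF X Y \<phi> comm] by metis
  obtain Q where Q: "finite Q" "UNIV \<subseteq> (\<Union>q\<in>Q. V q)"
    by (rule compactE_image[OF assms(1), of UNIV V]) (use V in auto)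
  have "Q \<noteq> {}" using Q(2) by auto
  define \<delta> where "\<delta> = Min (\<epsilon> ` Q)"
  have "\<delta> > 0" using V(3) Q(1) \<open>Q \<noteq> {}\<close> by (simp add: \<delta>_def)
  have short: "pushes_forward (\<phi> s) p (Y p) (Y (\<phi> s p))" if "0 \<le> s" "s \<le> \<delta>" for s p
  proof -
    obtain q where "q \<in> Q" "p \<in> V q" using Q(2) by blast
    moreover have "\<delta> \<le> \<epsilon> q" using \<open>q \<in> Q\<close> Q(1) by (simp add: \<delta>_def)
    ultimately show ?thesis using loc that by simp
  qed
  obtain n :: nat where "t / \<delta> < real n" using reals_Archimedean2 by blast
  moreover have "0 \<le> t / \<delta>" using \<open>\<delta> > 0\<close> \<open>0 \<le> t\<close> by simp
  ultimately have "0 < real n" "t < \<delta> * real n"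
    using \<open>\<delta> > 0\<close> by (linarith, simp add: pos_divide_less_eq mult.commute)
  then have n: "real n * (t / real n) = t" "0 \<le> t / real n" "t / real n \<le> \<delta>"
    using \<open>0 \<le> t\<close> by (simp_all add: pos_divide_le_eq)
  define \<sigma> where "\<sigma> = t / real n"
  have "pushes_forward (\<phi> (real k * \<sigma>)) p (Y p) (Y (\<phi> (real k * \<sigma>) p))" for k
  proof (induction k)
    case 0
    show ?case using short[of 0] \<open>\<delta> > 0\<close> by simp
  next
    case (Suc k)
    have eq: "\<phi> (real (Suc k) * \<sigma>) = \<phi> \<sigma> \<circ> \<phi> (real k * \<sigma>)"
      using flow_add[OF X \<phi>, of \<sigma> "real k * \<sigma>"] by (simp add: fun_eq_iff algebra_simps)
    have "pushes_forward (\<phi> \<sigma> \<circ> \<phi> (real k * \<sigma>)) p (Y p) (Y (\<phi> \<sigma> (\<phi> (real k * \<sigma>) p)))"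
      using n(2,3) by (intro pushes_forward_comp[OF Suc] short vector_fieldD(1)[OF Y]) (simp_all add: \<sigma>_def)
    then show ?case by (simp only: eq o_def)
  qed
  from this[of n] n(1) show ?thesis by (simp add: \<sigma>_def)
qed

section \<open>Commuting fields are proportional on the invariant set\<close>

text \<open>
  Since the splitting is invariant and its components are unique, the stable and the unstable part
  of a fixed vector are fixed too. Their norms are then bounded by \<open>C \<mu>\<^bsup>n T\<^esup>\<close> times themselves for
  all \<open>n\<close>, hence vanish.
\<close>

lemma hyperbolic_fixed_vector:
  assumes g: "riemannian_metric A g" and hyp: "hyperbolic_set A g X \<phi> K"
    and q: "q \<in> K" and "0 < T" and per: "\<And>n::nat. \<phi> (real n * T) q = q"
    and lin: "\<And>n::nat. linear (tangent_map A (\<phi> (real n * T)) q)"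
    and v: "v \<in> tangent_space A q" and fixed: "\<And>n::nat. tangent_map A (\<phi> (real n * T)) q v = v"
  shows "X q \<noteq> 0" "v \<in> span {X q}"
proof -
  obtain Es E0 Eu C \<mu> where "0 < C" "0 < \<mu>" "\<mu> < 1"
    and K: "\<And>x. x \<in> K \<Longrightarrow>
         direct_sum3 (tangent_space A x) (Es x) (E0 x) (Eu x) \<and>
         X x \<noteq> 0 \<and> E0 x = span {X x} \<and>
         (\<forall>t. tangent_map A (\<phi> t) x ` Es x = Es (\<phi> t x) \<and>
              tangent_map A (\<phi> t) x ` E0 x = E0 (\<phi> t x) \<and>
              tangent_map A (\<phi> t) x ` Eu x = Eu (\<phi> t x)) \<and>
         (\<forall>t\<ge>0. \<forall>v\<in>Es x.
            tnorm g (\<phi> t x) (tangent_map A (\<phi> t) x v) \<le> C * \<mu> powr t * tnorm g x v) \<and>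
         (\<forall>t\<ge>0. \<forall>v\<in>Eu x.
            tnorm g x v \<le> C * \<mu> powr t * tnorm g (\<phi> t x) (tangent_map A (\<phi> t) x v))"
    using hyp unfolding hyperbolic_set_def by metis
  note Kq = K[OF q]
  then show "X q \<noteq> 0" by blast
  from Kq have sum: "direct_sum3 (tangent_space A q) (Es q) (E0 q) (Eu q)" by blast
  then have sub: "Es q \<subseteq> tangent_space A q" "Eu q \<subseteq> tangent_space A q"
    and ex1: "\<exists>!x. case x of (a, b, c) \<Rightarrow> a \<in> Es q \<and> b \<in> E0 q \<and> c \<in> Eu q \<and> v = a + b + c"
    using v by (simp_all add: direct_sum3_def)
  obtain a b c where abc: "a \<in> Es q" "b \<in> E0 q" "c \<in> Eu q" "v = a + b + c"
    using ex1_implies_ex[OF ex1] by auto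
  have uniq: "a = a' \<and> b = b' \<and> c = c'"
    if "a' \<in> Es q" "b' \<in> E0 q" "c' \<in> Eu q" "v = a' + b' + c'" for a' b' c'
    using Uniq_D[OF ex1_iff_ex_Uniq[THEN iffD1, OF ex1, THEN conjunct2], of "(a, b, c)" "(a', b', c')"] abc that
    by simp
  have fix_ac: "tangent_map A (\<phi> (real n * T)) q a = a \<and> tangent_map A (\<phi> (real n * T)) q c = c" for n :: nat
  proof -
    let ?D = "tangent_map A (\<phi> (real n * T)) q"
    have "?D ` Es q = Es (\<phi> (real n * T) q)" "?D ` E0 q = E0 (\<phi> (real n * T) q)"
      "?D ` Eu q = Eu (\<phi> (real n * T) q)"
      using Kq by blast+
    then have "?D a \<in> Es q" "?D b \<in> E0 q" "?D c \<in> Eu q" using abc unfolding per by blast+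
    moreover have "v = ?D a + ?D b + ?D c"
      using fixed[of n] lin[of n] by (simp add: abc(4) linear_add)
    ultimately show ?thesis using uniq[of "?D a" "?D b" "?D c"] by simp
  qed
  have vanish: "w = 0" if w: "w \<in> tangent_space A q"
    and contr: "\<And>n::nat. tnorm g q w \<le> C * \<mu> powr (real n * T) * tnorm g q w" for w
  proof (rule ccontr)
    assume "w \<noteq> 0"
    then have "g q w w > 0" using g w unfolding riemannian_metric_def by blast
    then have N: "tnorm g q w > 0" by (simp add: tnorm_def)
    \<comment> \<open>Cancelling the norm leaves a bound that the powers of \<open>\<mu>\<^bsup>T\<^esup>\<close> violate in the limit.\<close>
    have one: "1 \<le> C * (\<mu> powr T) ^ n" for n :: nat
    proof -
      have "\<mu> powr (real n * T) = (\<mu> powr T) ^ n"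
        using \<open>0 < \<mu>\<close> by (simp add: powr_powr[symmetric] powr_realpow mult.commute)
      then show ?thesis using contr[of n] N by simp
    qed
    have "\<mu> powr T < 1" using \<open>0 < T\<close> \<open>0 < \<mu>\<close> \<open>\<mu> < 1\<close> using powr_less_mono2[of T \<mu> 1] by simp
    then have "(\<lambda>n. C * (\<mu> powr T) ^ n) \<longlonglongrightarrow> C * 0"
      by (intro tendsto_intros LIMSEQ_realpow_zero) auto
    then have "1 \<le> C * 0" by (rule LIMSEQ_le_const) (use one in blast)
    then show False by simp
  qed
  have "a = 0"
  proof (rule vanish)
    fix n :: nat
    have "tnorm g (\<phi> (real n * T) q) (tangent_map A (\<phi> (real n * T)) q a)
        \<le> C * \<mu> powr (real n * T) * tnorm g q a"
      using Kq abc(1) \<open>0 < T\<close> by simp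
    then show "tnorm g q a \<le> C * \<mu> powr (real n * T) * tnorm g q a" by (simp add: per fix_ac)
  qed (use abc sub in auto)
  moreover have "c = 0"
  proof (rule vanish)
    fix n :: nat
    have "tnorm g q c \<le> C * \<mu> powr (real n * T) *
        tnorm g (\<phi> (real n * T) q) (tangent_map A (\<phi> (real n * T)) q c)"
      using Kq abc(3) \<open>0 < T\<close> by simp
    then show "tnorm g q c \<le> C * \<mu> powr (real n * T) * tnorm g q c" by (simp add: per fix_ac)
  qed (use abc sub in auto)
  ultimately show "v \<in> span {X q}" using abc Kq by simp
qed

text \<open>
  After each multiple of the period the flow returns to \<open>q\<close>, so its differential there fixes \<open>Y q\<close>.
\<close>

lemma commuting_field_on_hyperbolic_periodic_orbit:
  assumes M: "compact (UNIV :: 'm set)" and g: "riemannian_metric A g"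
    and X: "X \<in> vector_fields A 1" and Y: "Y \<in> vector_fields A 1"
    and \<phi>: "flow_generated_by A X \<phi>" and comm: "\<And>p. lie_bracket A X Y p = 0"
    and p: "hyperbolic_periodic_point A g X \<phi> p" and q: "q \<in> flow_orbit \<phi> p"
  shows "X q \<noteq> 0" "\<exists>k. Y q = k *\<^sub>R X q"
proof -
  obtain T where T: "T > 0" "\<phi> T p = p"
    using p unfolding hyperbolic_periodic_point_def periodic_point_def by blast
  obtain s where s: "q = \<phi> s p" using q by (auto simp: flow_orbit_def)
  have "\<phi> T q = q"
    using flow_add[OF X \<phi>, of T s p] flow_add[OF X \<phi>, of s T p] T(2) by (simp add: s add.commute)
  have per: "\<phi> (real n * T) q = q" for n
  proof (induction n)
    case (Suc n)
    then show ?case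
      using flow_add[OF X \<phi>, of T "real n * T" q] \<open>\<phi> T q = q\<close> by (simp add: algebra_simps)
  qed (simp add: flow_zero[OF \<phi>])
  have push: "pushes_forward (\<phi> (real n * T)) q (Y q) (Y q)" for n
    using flow_pushes_forward[OF M X Y \<phi> comm, of "real n * T" q] T(1) per by simp
  have hyp: "hyperbolic_set A g X \<phi> (flow_orbit \<phi> p)"
    using p by (simp add: hyperbolic_periodic_point_def)
  note * = hyperbolic_fixed_vector[OF g hyp q T(1) per linear_tangent_map[OF push] vector_fieldD(1)[OF Y]
    tangent_map_eq[OF push]]
  show "X q \<noteq> 0" using *(1) vector_fieldD(1)[OF Y] by (simp add: per)
  show "\<exists>k. Y q = k *\<^sub>R X q"
    using *(2) vector_fieldD(1)[OF Y] by (auto simp: per span_singleton)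
qed

text \<open>
  The differential of the flow is linear and carries \<open>X\<close> to \<open>X\<close> and \<open>Y\<close> to \<open>Y\<close>, so the factor \<open>k\<close>
  is transported unchanged along the forward orbit; continuity extends the relation to the closure.
\<close>

lemma proportional_on_orbit_closure:
  assumes M: "compact (UNIV :: 'm set)"
    and X: "X \<in> vector_fields A 1" and Y: "Y \<in> vector_fields A 1"
    and \<phi>: "flow_generated_by A X \<phi>" and comm: "\<And>p. lie_bracket A X Y p = 0"
    and eq: "Y x0 = k *\<^sub>R X x0" and x: "x \<in> closure ((\<lambda>t. \<phi> t x0) ` {0..})"
  shows "Y x = k *\<^sub>R X x"
proof -
  have orbit: "Y (\<phi> t x0) = k *\<^sub>R X (\<phi> t x0)" if "0 \<le> t" for t
  proof -
    let ?D = "tangent_map A (\<phi> t) x0"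
    have XX: "lie_bracket A X X p = 0" for p by (simp add: lie_bracket_def fun_eq_iff)
    note push = flow_pushes_forward[OF M X X \<phi> XX that]
    have "?D (Y x0) = Y (\<phi> t x0)"
      by (rule tangent_map_eq[OF flow_pushes_forward[OF M X Y \<phi> comm that] vector_fieldD(1)[OF Y]])
    moreover have "?D (X x0) = X (\<phi> t x0)"
      by (rule tangent_map_eq[OF push vector_fieldD(1)[OF X]])
    ultimately show ?thesis
      using linear_tangent_map[OF push] by (metis eq linear_scale)
  qed
  obtain c where c: "c \<in> charts_at A x" using charts_at_nonempty by blast
  note c' = charts_atD[OF c]
  have "Y x c = k *\<^sub>R X x c"
    by (rule eq_on_closure[where F = "\<lambda>x. Y x c" and G = "\<lambda>x. k *\<^sub>R X x c",
          OF _ _ chart_homeomorphism(1)[OF c'(1)] c'(2) x])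
      (auto intro: continuous_on_scaleR[OF continuous_on_const] vector_field_continuous_on[OF X c'(1)]
          vector_field_continuous_on[OF Y c'(1)] simp: orbit scaleR_fun_def)
  then show ?thesis
    by (rule proportional_if_in_one_chart[OF vector_fieldD(1)[OF Y] vector_fieldD(1)[OF X] c])
qed

end

theorem theorem1:
  fixes A :: "('m::t2_space, 'e::euclidean_space) chart set"
    and g :: "'m \<Rightarrow> ('m, 'e) tvec \<Rightarrow> ('m, 'e) tvec \<Rightarrow> real"
    and X :: "('m, 'e) vfield"
    and \<phi> :: "real \<Rightarrow> 'm \<Rightarrow> 'm"
    and r :: nat
    and \<Lambda> :: "'m set"
  assumes "smooth_atlas A"
    and "compact (UNIV :: 'm set)"
    and "connected (UNIV :: 'm set)"
    and "riemannian_metric A g"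
    and "r \<ge> 1"
    and "X \<in> vector_fields A r"
    and "flow_generated_by A X \<phi>"
    and "compact \<Lambda>"
    and "flow_preserves \<phi> \<Lambda>"
    and "transitive_set \<phi> \<Lambda>"
    and "hyperbolic_periodic_orbits_dense A g X \<phi> \<Lambda>"
  shows "\<forall>Y \<in> centralizer A X.
           (\<forall>\<psi>. flow_generated_by A Y \<psi> \<longrightarrow> flow_preserves \<psi> \<Lambda>) \<and>
           (\<exists>c::real. \<forall>x\<in>\<Lambda>. Y x = c *\<^sub>R X x)"
proof
  fix Y assume "Y \<in> centralizer A X"
  interpret smooth_manifold A by unfold_locales (rule assms(1))
  note M = assms(2) and \<phi> = assms(7)
  have X: "X \<in> vector_fields A 1"
    using assms(5,6) Ck_on_1_mono unfolding vector_fields_def by blast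
  have Y: "Y \<in> vector_fields A 1" and comm: "\<And>p. lie_bracket A X Y p = 0"
    using \<open>Y \<in> centralizer A X\<close> by (auto simp: centralizer_def)
  define P where "P = \<Union> {flow_orbit \<phi> p | p.
           hyperbolic_periodic_point A g X \<phi> p \<and> flow_orbit \<phi> p \<subseteq> \<Lambda>}"
  have dense: "\<Lambda> \<subseteq> closure P"
    using assms(11) by (simp add: hyperbolic_periodic_orbits_dense_def P_def)
  have P: "q \<in> \<Lambda> \<and> X q \<noteq> 0 \<and> (\<exists>k. Y q = k *\<^sub>R X q)" if "q \<in> P" for q
    using that commuting_field_on_hyperbolic_periodic_orbit[OF M assms(4) X Y \<phi> comm]
    unfolding P_def by blast
  obtain x0 where x0: "x0 \<in> \<Lambda>" "\<Lambda> \<subseteq> closure ((\<lambda>t. \<phi> t x0) ` {0..})"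
    using assms(10) by (auto simp: transitive_set_def)
  \<comment> \<open>Otherwise \<open>X\<close> vanishes on \<open>\<Lambda>\<close>, the closure of an orbit, and \<open>\<Lambda>\<close> contains hyperbolic periodic orbits; on those \<open>X \<noteq> 0\<close>.\<close>
  have "X x0 \<noteq> 0"
  proof
    assume "X x0 = 0"
    then have "X x0 = 0 *\<^sub>R X x0" by simp
    moreover have "lie_bracket A X X p = 0" for p by (simp add: lie_bracket_def fun_eq_iff)
    ultimately have "X x = 0 *\<^sub>R X x" if "x \<in> \<Lambda>" for x
      using proportional_on_orbit_closure[OF M X X \<phi>] x0(2) that by blast
    then have "P = {}" using P by auto
    then show False using dense x0(1) by auto
  qed
  have "\<exists>k. Y x0 = k *\<^sub>R X x0"
  proof -
    obtain c where c: "c \<in> charts_at A x0" using charts_at_nonempty by blast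
    note c' = charts_atD[OF c]
    \<comment> \<open>Unlike the existence of a factor, this form of proportionality is a closed condition.\<close>
    have "(X x0 c \<bullet> X x0 c) *\<^sub>R Y x0 c = (X x0 c \<bullet> Y x0 c) *\<^sub>R X x0 c"
    proof (rule eq_on_closure[OF _ _ chart_homeomorphism(1)[OF c'(1)] c'(2)])
      show "x0 \<in> closure P" using dense x0(1) by blast
      fix q assume "q \<in> P"
      then obtain k where "Y q = k *\<^sub>R X q" using P by blast
      then show "(X q c \<bullet> X q c) *\<^sub>R Y q c = (X q c \<bullet> Y q c) *\<^sub>R X q c"
        by (simp add: scaleR_fun_def)
    qed (intro continuous_intros vector_field_continuous_on X Y c')+
    moreover have "X x0 c \<noteq> 0"
      using proportional_if_in_one_chart[OF vector_fieldD(1)[OF X] vector_fieldD(1)[OF X] c, of 0] \<open>X x0 \<noteq> 0\<close>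
      by auto
    ultimately have "Y x0 c = ((X x0 c \<bullet> Y x0 c) / (X x0 c \<bullet> X x0 c)) *\<^sub>R X x0 c"
      by (simp add: eq_vector_fraction_iff)
    then show ?thesis
      using proportional_if_in_one_chart[OF vector_fieldD(1)[OF Y] vector_fieldD(1)[OF X] c] by blast
  qed
  then obtain k where "Y x0 = k *\<^sub>R X x0" by blast
  then have k: "Y x = k *\<^sub>R X x" if "x \<in> \<Lambda>" for x
    using proportional_on_orbit_closure[OF M X Y \<phi> comm] x0(2) that by blast
  have inv: "\<phi> t ` \<Lambda> = \<Lambda>" for t using assms(9) by (simp add: flow_preserves_def)
  have "flow_preserves \<psi> \<Lambda>" if \<psi>: "flow_generated_by A Y \<psi>" for \<psi>
  proof -
    have "\<psi> t x = \<phi> (k * t) x" if "x \<in> \<Lambda>" for t x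
    proof -
      have "\<phi> s x \<in> \<Lambda>" for s using inv that by blast
      then have "integral_curve A Y (\<lambda>t. \<phi> (k * t + 0) x)"
        by (intro integral_curve_affine[OF flow_integral_curve[OF \<phi>]] k)
      then show ?thesis
        using integral_curve_unique[OF Y flow_integral_curve[OF \<psi>], of "\<lambda>t. \<phi> (k * t + 0) x"]
        by (simp add: flow_zero[OF \<phi>] flow_zero[OF \<psi>])
    qed
    then show ?thesis by (simp add: flow_preserves_def inv cong: image_cong)
  qed
  then show "(\<forall>\<psi>. flow_generated_by A Y \<psi> \<longrightarrow> flow_preserves \<psi> \<Lambda>) \<and>
      (\<exists>c::real. \<forall>x\<in>\<Lambda>. Y x = c *\<^sub>R X x)"
    using k by blast
qed

end
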